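(* A generic binary sextic (over $\mathbb{C}$) is linearly equivalent to a sextic in Sylvester Canonical Form. Any exceptional sextic (i.e. any binary sextic not linearly equivalent to a sextic in Sylvester Canonical Form) is linearly equivalent to exactly one of the following seven sextics: (i) $z_1^4z_2^2$; (ii) $z_1^4(z_1^2+z_2^2)$; (iii) $z_1^3z_2^3$; (iv) $z_1^5z_2$; (v) $z_1(z_1^5+z_2^5)$; (vi) $2z_1^6+18z_1^5z_2+10z_1^3z_2^3-z_2^6$; (vii) $184z_1^6-192z_1^5z_2-300z_1^4z_2^2-320z_1^3z_2^3-150z_1^2z_2^4-48z_1z_2^5+23z_2^6$.
   Context: A binary sextic is a homogeneous polynomial of degree 6 in two complex variables $z_1,z_2$. Two binary sextics are linearly equivalent if one is obtained from the other by an invertible linear change of variables from $\mathrm{GL}(2,\mathbb{C})$. A sextic is in Sylvester Canonical Form if it is of the form $$au^6+bv^6+cw^6+d\,uvw(u-v)(v-w)(w-u)$$ for some $a,b,c,d\in\mathbb{C}$ and linear forms $u,v,w$ in $z_1,z_2$ satisfying $u+v+w=0$, any two of which are linearly independent. "Generic" means: belonging to some non-empty Zariski open subset of the space of binary sextics. *)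

theory Defs
  imports "HOL-Analysis.Analysis"
begin

text \<open>
  Since \<open>\<complex>\<close> is infinite, forms are identified with the polynomial functions
  on \<open>\<complex>\<^sup>2\<close> that they induce. Only \<open>c 0, \<dots>, c n\<close> matter below, and they are
  determined by \<open>form_of n c\<close>.
\<close>

definition form_of :: "nat \<Rightarrow> (nat \<Rightarrow> complex) \<Rightarrow> complex^2 \<Rightarrow> complex" where
  "form_of n c = (\<lambda>z. \<Sum>k\<le>n. c k * (z $ 1) ^ (n - k) * (z $ 2) ^ k)"

definition binary_forms :: "nat \<Rightarrow> (complex^2 \<Rightarrow> complex) set" where
  "binary_forms n = range (form_of n)"

abbreviation binary_sextics :: "(complex^2 \<Rightarrow> complex) set" where
  "binary_sextics \<equiv> binary_forms 6"

abbreviation linear_forms :: "(complex^2 \<Rightarrow> complex) set" where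
  "linear_forms \<equiv> binary_forms 1"

definition linearly_equivalent ::
    "(complex^2 \<Rightarrow> complex) \<Rightarrow> (complex^2 \<Rightarrow> complex) \<Rightarrow> bool" where
  "linearly_equivalent f g \<longleftrightarrow>
     (\<exists>A :: complex^2^2. invertible A \<and> g = (\<lambda>z. f (A *v z)))"

text \<open>Independence over \<open>\<complex>\<close>; the library's \<^const>\<open>independent\<close> is over the reals.\<close>

definition lin_indep2 :: "(complex^2 \<Rightarrow> complex) \<Rightarrow> (complex^2 \<Rightarrow> complex) \<Rightarrow> bool" where
  "lin_indep2 u v \<longleftrightarrow>
     (\<forall>s t :: complex. (\<forall>z. s * u z + t * v z = 0) \<longrightarrow> s = 0 \<and> t = 0)"

definition sylvester_canonical :: "(complex^2 \<Rightarrow> complex) \<Rightarrow> bool" where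
  "sylvester_canonical f \<longleftrightarrow>
     (\<exists>a b c d :: complex. \<exists>u \<in> linear_forms. \<exists>v \<in> linear_forms. \<exists>w \<in> linear_forms.
        (\<forall>z. u z + v z + w z = 0) \<and>
        lin_indep2 u v \<and> lin_indep2 v w \<and> lin_indep2 u w \<and>
        f = (\<lambda>z. a * u z ^ 6 + b * v z ^ 6 + c * w z ^ 6 +
               d * (u z * v z * w z * (u z - v z) * (v z - w z) * (w z - u z))))"

text \<open>Polynomials in the \<open>n + 1\<close> coefficients \<open>c 0, \<dots>, c n\<close>.\<close>

inductive coeff_polynomial :: "nat \<Rightarrow> ((nat \<Rightarrow> complex) \<Rightarrow> complex) \<Rightarrow> bool"
  for n :: nat where
  const: "coeff_polynomial n (\<lambda>c. a)"
| coord: "k \<le> n \<Longrightarrow> coeff_polynomial n (\<lambda>c. c k)"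
| add: "coeff_polynomial n p \<Longrightarrow> coeff_polynomial n q \<Longrightarrow> coeff_polynomial n (\<lambda>c. p c + q c)"
| mult: "coeff_polynomial n p \<Longrightarrow> coeff_polynomial n q \<Longrightarrow> coeff_polynomial n (\<lambda>c. p c * q c)"

text \<open>
  Zariski topology on the space of binary forms of degree \<open>n\<close>, identified with
  \<open>\<complex>\<^bsup>n+1\<^esup>\<close> through the coefficients: the open sets are the complements of the
  common zero sets of arbitrary sets of polynomials.
\<close>

definition zariski_open :: "nat \<Rightarrow> (complex^2 \<Rightarrow> complex) set \<Rightarrow> bool" where
  "zariski_open n U \<longleftrightarrow>
     (\<exists>P. (\<forall>p \<in> P. coeff_polynomial n p) \<and>
          U = form_of n ` {c. \<exists>p \<in> P. p c \<noteq> 0})"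

definition exceptional_sextic :: "(complex^2 \<Rightarrow> complex) \<Rightarrow> bool" where
  "exceptional_sextic f \<longleftrightarrow>
     f \<in> binary_sextics \<and> \<not> (\<exists>g. sylvester_canonical g \<and> linearly_equivalent f g)"

text \<open>A list, so that \<open>exactly one\<close> refers to the position and not merely to the form.\<close>

definition exceptional_list :: "(complex^2 \<Rightarrow> complex) list" where
  "exceptional_list =
    [\<lambda>z. (z $ 1)^4 * (z $ 2)^2,
     \<lambda>z. (z $ 1)^4 * ((z $ 1)^2 + (z $ 2)^2),
     \<lambda>z. (z $ 1)^3 * (z $ 2)^3,
     \<lambda>z. (z $ 1)^5 * z $ 2,
     \<lambda>z. z $ 1 * ((z $ 1)^5 + (z $ 2)^5),
     \<lambda>z. 2 * (z $ 1)^6 + 18 * (z $ 1)^5 * z $ 2 + 10 * (z $ 1)^3 * (z $ 2)^3 - (z $ 2)^6,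
     \<lambda>z. 184 * (z $ 1)^6 - 192 * (z $ 1)^5 * z $ 2 - 300 * (z $ 1)^4 * (z $ 2)^2
        - 320 * (z $ 1)^3 * (z $ 2)^3 - 150 * (z $ 1)^2 * (z $ 2)^4
        - 48 * z $ 1 * (z $ 2)^5 + 23 * (z $ 2)^6]"

end

theory Submission
  imports Defs "HOL-Computational_Algebra.Fundamental_Theorem_Algebra"
begin

text \<open>
  Write a sextic as \<open>f = \<Sum>k\<le>6. (6 choose k) a\<^sub>k x\<^bsup>6-k\<^esup> y\<^bsup>k\<^esup>\<close>, where \<open>x\<close> and \<open>y\<close> are the two variables.
  Up to a constant factor, the third transvectant with \<open>f\<close> is a linear operator on binary cubics,
  i.e. on a space of dimension 4, and it is compatible with linear changes of variables. The whole
  proof is about its eigenvectors, called eigencubics of \<open>f\<close> below.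

  For a cubic \<open>g = uvw\<close> with \<open>u + v + w = 0\<close> and no repeated factor, the sextics that have \<open>g\<close> as an
  eigencubic form the span of \<open>u\<^sup>6, v\<^sup>6, w\<^sup>6\<close> and \<open>uvw(u-v)(v-w)(w-u)\<close>: the transvectant of
  \<open>u\<^sup>6\<close> with \<open>g\<close> is a multiple of \<open>u\<^sup>3\<close> by the value of \<open>g\<close> at the zero of \<open>u\<close>, hence vanishes,
  and the last form, a multiple of the product of \<open>g\<close> with its cubic covariant, accounts for the eigenvalue. So \<open>f\<close> is equivalent to a sextic in Sylvester canonical form as soon as
  one of its eigencubics has nonzero discriminant (\<open>sylvester_reducible_if_eigencubic\<close>), and for an
  exceptional \<open>f\<close> every eigencubic has a repeated factor.

  Eigencubics exist (\<open>ex_eigencubic\<close>). If one has a repeated factor, a change of variables makes it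
  \<open>x\<^sup>2 y\<close> or \<open>x\<^sup>3\<close>, and the eigenvector equation then forces \<open>a\<^sub>2 = a\<^sub>4 = a\<^sub>5 = 0\<close> or
  \<open>a\<^sub>4 = a\<^sub>5 = a\<^sub>6 = 0\<close> (\<open>degenerate_eigencubic\<close>). For such sextics
  eigencubics can be written down explicitly. Requiring the discriminants of these to vanish as well gives polynomial
  equations for the few coefficients that are left, and these equations single out the seven forms;
  the two sporadic ones come from \<open>double_root_form_parameters\<close>.

  The characteristic polynomial of the operator is even, \<open>\<lambda>\<^sup>4 + I \<lambda>\<^sup>2 + 9 C\<close>, where \<open>I\<close> and \<open>C\<close> are the
  classical invariants of degrees 2 and 4, and \<open>C\<close> is the catalecticant. The ratio of \<open>I\<^sup>2\<close> to \<open>C\<close>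
  separates the third, sixth and seventh form from each other and from the other four, for which
  \<open>I = 0\<close>; the latter differ in the multiplicities of their linear factors. The same relations
  between \<open>I\<close> and \<open>C\<close> make a polynomial in the coefficients that vanishes on all seven orbits, and its
  nonvanishing is the generic condition.
\<close>

section \<open>Linear changes of variables\<close>

definition subst2 :: "complex \<Rightarrow> complex \<Rightarrow> complex \<Rightarrow> complex \<Rightarrow> complex^2 \<Rightarrow> complex^2" where
  "subst2 p q r s z = vector [p * z $ 1 + q * z $ 2, r * z $ 1 + s * z $ 2]"

lemma subst2_nth [simp]:
  "subst2 p q r s z $ 1 = p * z $ 1 + q * z $ 2"
  "subst2 p q r s z $ 2 = r * z $ 1 + s * z $ 2"
  by (simp_all add: subst2_def)

lemma vec2_eq_iff: "(z :: complex^2) = w \<longleftrightarrow> z $ 1 = w $ 1 \<and> z $ 2 = w $ 2"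
  by (simp add: vec_eq_iff forall_2)

lemma matrix_vector_mult_eq_subst2:
  "(A :: complex^2^2) *v z = subst2 (A $ 1 $ 1) (A $ 1 $ 2) (A $ 2 $ 1) (A $ 2 $ 2) z"
  by (simp add: vec2_eq_iff matrix_vector_mult_def sum_2)

lemma linearly_equivalent_iff_subst2:
  "linearly_equivalent f g \<longleftrightarrow>
     (\<exists>p q r s. p * s - q * r \<noteq> 0 \<and> g = (\<lambda>z. f (subst2 p q r s z)))"
proof
  assume "linearly_equivalent f g"
  then obtain A :: "complex^2^2" where "invertible A" "g = (\<lambda>z. f (A *v z))"
    by (auto simp: linearly_equivalent_def)
  then show "\<exists>p q r s. p * s - q * r \<noteq> 0 \<and> g = (\<lambda>z. f (subst2 p q r s z))"
    by (intro exI[of _ "A $ 1 $ 1"] exI[of _ "A $ 1 $ 2"] exI[of _ "A $ 2 $ 1"] exI[of _ "A $ 2 $ 2"])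
      (simp add: invertible_det_nz det_2 matrix_vector_mult_eq_subst2 mult.commute)
next
  assume "\<exists>p q r s. p * s - q * r \<noteq> 0 \<and> g = (\<lambda>z. f (subst2 p q r s z))"
  then obtain p q r s where *: "p * s - q * r \<noteq> 0" "g = (\<lambda>z. f (subst2 p q r s z))"
    by blast
  define A :: "complex^2^2" where "A = vector [vector [p, q], vector [r, s]]"
  have "invertible A"
    using * by (simp add: invertible_det_nz det_2 A_def)
  moreover have "g = (\<lambda>z. f (A *v z))"
    using * by (simp add: matrix_vector_mult_eq_subst2 A_def)
  ultimately show "linearly_equivalent f g"
    unfolding linearly_equivalent_def by blast
qed

lemma linearly_equivalent_subst2:
  "p * s - q * r \<noteq> 0 \<Longrightarrow> linearly_equivalent f (\<lambda>z. f (subst2 p q r s z))"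
  unfolding linearly_equivalent_iff_subst2 by blast

lemma linearly_equivalent_refl [simp]: "linearly_equivalent f f"
proof -
  have "subst2 1 0 0 1 z = z" for z
    by (simp add: vec2_eq_iff)
  then show ?thesis
    using linearly_equivalent_subst2[of 1 1 0 0 f] by simp
qed

lemma linearly_equivalent_trans [trans]:
  assumes "linearly_equivalent f g" "linearly_equivalent g h"
  shows "linearly_equivalent f h"
proof -
  obtain A B :: "complex^2^2" where "invertible A" "g = (\<lambda>z. f (A *v z))"
    "invertible B" "h = (\<lambda>z. g (B *v z))"
    using assms by (auto simp: linearly_equivalent_def)
  then have "invertible (A ** B)" "h = (\<lambda>z. f ((A ** B) *v z))"
    by (simp_all add: invertible_mult matrix_vector_mul_assoc)
  then show ?thesis
    unfolding linearly_equivalent_def by blast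
qed

lemma linearly_equivalent_sym:
  assumes "linearly_equivalent f g"
  shows "linearly_equivalent g f"
proof -
  obtain A :: "complex^2^2" where A: "invertible A" "g = (\<lambda>z. f (A *v z))"
    using assms by (auto simp: linearly_equivalent_def)
  then obtain B where B: "A ** B = mat 1" "B ** A = mat 1"
    by (auto simp: invertible_def)
  then have "invertible B"
    by (auto simp: invertible_def)
  moreover have "f = (\<lambda>z. g (B *v z))"
    using A B by (simp add: matrix_vector_mul_assoc)
  ultimately show ?thesis
    unfolding linearly_equivalent_def by blast
qed

text \<open>
  Gaussian elimination for matrices of order 2: a property that survives shears, the exchange of the
  variables and their rescaling is invariant under all invertible substitutions. Covariance then has to
  be checked only for these three, where it is a polynomial identity of manageable size.
\<close>

lemma linearly_equivalent_induct:
  assumes equiv: "linearly_equivalent f g"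
    and refl: "R f"
    and shear: "\<And>h s. R h \<Longrightarrow> R (\<lambda>z. h (subst2 1 s 0 1 z))"
    and swap: "\<And>h. R h \<Longrightarrow> R (\<lambda>z. h (subst2 0 1 1 0 z))"
    and diag: "\<And>h p q. R h \<Longrightarrow> p \<noteq> 0 \<Longrightarrow> q \<noteq> 0 \<Longrightarrow> R (\<lambda>z. h (subst2 p 0 0 q z))"
  shows "R g"
proof -
  have *: "R (\<lambda>z. h (subst2 p q r s z))" if "R h" "p \<noteq> 0" "p * s - q * r \<noteq> 0" for h p q r s
  proof -
    \<comment> \<open>Lower triangular times diagonal times upper triangular; conjugating a shear by the
      exchange of the variables makes it lower triangular.\<close>
    have eq: "subst2 p q r s z =
      subst2 0 1 1 0 (subst2 1 (r / p) 0 1 (subst2 0 1 1 0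
        (subst2 p 0 0 (s - q * r / p) (subst2 1 (q / p) 0 1 z))))" for z
      using \<open>p \<noteq> 0\<close> by (simp add: vec2_eq_iff field_simps)
    have "s - q * r / p \<noteq> 0"
      using that by (simp add: field_simps)
    then show ?thesis
      unfolding eq
      using \<open>p \<noteq> 0\<close>
      by (intro shear[of "\<lambda>z. h (subst2 0 1 1 0 (subst2 1 (r / p) 0 1 (subst2 0 1 1 0
            (subst2 p 0 0 (s - q * r / p) z))))"]
          diag[of "\<lambda>z. h (subst2 0 1 1 0 (subst2 1 (r / p) 0 1 (subst2 0 1 1 0 z)))"]
          swap[of "\<lambda>z. h (subst2 0 1 1 0 (subst2 1 (r / p) 0 1 z))"]
          shear[of "\<lambda>z. h (subst2 0 1 1 0 z)"] swap[of h] \<open>R h\<close>)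
  qed
  obtain p q r s where pqrs: "p * s - q * r \<noteq> 0" "g = (\<lambda>z. f (subst2 p q r s z))"
    using equiv unfolding linearly_equivalent_iff_subst2 by blast
  show ?thesis
  proof (cases "p = 0")
    case False
    then show ?thesis
      using * pqrs refl by blast
  next
    case True
    then have "R (\<lambda>z. f (subst2 0 1 1 0 (subst2 r s p q z)))"
      using pqrs by (intro *[of "\<lambda>z. f (subst2 0 1 1 0 z)"] swap refl) (auto simp: algebra_simps)
    moreover have "subst2 0 1 1 0 (subst2 r s p q z) = subst2 p q r s z" for z
      by (simp add: vec2_eq_iff)
    ultimately show ?thesis
      using pqrs by simp
  qed
qed

section \<open>Sextics in terms of their coefficients\<close>

text \<open>
  With binomial weights a shear transforms the coefficients by the same formula in every degree, so that
  sextics and cubics are treated alike.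
\<close>

definition sextic :: "(nat \<Rightarrow> complex) \<Rightarrow> complex^2 \<Rightarrow> complex" where
  "sextic a z = (\<Sum>k\<le>6. of_nat (6 choose k) * a k * (z $ 1) ^ (6 - k) * (z $ 2) ^ k)"

lemma sextic_expand:
  "sextic a z = a 0 * (z $ 1) ^ 6 + 6 * a 1 * (z $ 1) ^ 5 * z $ 2 + 15 * a 2 * (z $ 1) ^ 4 * (z $ 2) ^ 2
     + 20 * a 3 * (z $ 1) ^ 3 * (z $ 2) ^ 3 + 15 * a 4 * (z $ 1) ^ 2 * (z $ 2) ^ 4
     + 6 * a 5 * z $ 1 * (z $ 2) ^ 5 + a 6 * (z $ 2) ^ 6"
  by (simp add: sextic_def eval_nat_numeral binomial_eq_0 flip: power_Suc power_Suc2)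

lemma binary_sextic_iff: "f \<in> binary_sextics \<longleftrightarrow> (\<exists>a. f = sextic a)"
proof
  assume "f \<in> binary_sextics"
  then obtain c where "f = form_of 6 c"
    by (auto simp: binary_forms_def)
  then have "f = sextic (\<lambda>k. c k / of_nat (6 choose k))"
    by (auto simp: form_of_def sextic_def fun_eq_iff intro!: sum.cong)
  then show "\<exists>a. f = sextic a"
    by blast
next
  assume "\<exists>a. f = sextic a"
  then obtain a where "f = sextic a" ..
  then have "f = form_of 6 (\<lambda>k. of_nat (6 choose k) * a k)"
    by (simp add: form_of_def sextic_def fun_eq_iff)
  then show "f \<in> binary_sextics"
    by (simp add: binary_forms_def)
qed

lemma sextic_eqD:
  assumes "sextic a = sextic b" "k \<le> 6"
  shows "a k = b k"
proof -
  have "(\<Sum>k\<le>6. (of_nat (6 choose k) * (a k - b k)) * t ^ k) = 0" for t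
  proof -
    have "sextic a (vector [1, t]) = sextic b (vector [1, t])"
      using assms by simp
    then show ?thesis
      by (simp add: sextic_def sum_subtractf algebra_simps)
  qed
  then have "\<forall>k\<le>6. of_nat (6 choose k) * (a k - b k) = 0"
    using polyfun_eq_0[of "\<lambda>k. of_nat (6 choose k) * (a k - b k)" 6] by blast
  then show ?thesis
    using assms(2) by auto
qed

text \<open>
  The effect of \<open>x \<mapsto> x + s y\<close> on binomially weighted coefficients, for forms of every degree.
\<close>

definition shift :: "complex \<Rightarrow> (nat \<Rightarrow> complex) \<Rightarrow> nat \<Rightarrow> complex" where
  "shift s a k = (\<Sum>j\<le>k. of_nat (k choose j) * s ^ (k - j) * a j)"

lemma shift_simps:
  "shift s a 0 = a 0"
  "shift s a 1 = a 1 + s * a 0"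
  "shift s a 2 = a 2 + 2 * s * a 1 + s^2 * a 0"
  "shift s a 3 = a 3 + 3 * s * a 2 + 3 * s^2 * a 1 + s^3 * a 0"
  "shift s a 4 = a 4 + 4 * s * a 3 + 6 * s^2 * a 2 + 4 * s^3 * a 1 + s^4 * a 0"
  "shift s a 5 = a 5 + 5 * s * a 4 + 10 * s^2 * a 3 + 10 * s^3 * a 2 + 5 * s^4 * a 1 + s^5 * a 0"
  "shift s a 6 = a 6 + 6 * s * a 5 + 15 * s^2 * a 4 + 20 * s^3 * a 3 + 15 * s^4 * a 2
     + 6 * s^5 * a 1 + s^6 * a 0"
  by (simp_all add: shift_def eval_nat_numeral binomial_eq_0 algebra_simps)

lemma sextic_shift: "sextic (shift s a) = (\<lambda>z. sextic a (subst2 1 s 0 1 z))"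
proof
  fix z
  show "sextic (shift s a) z = sextic a (subst2 1 s 0 1 z)"
    unfolding sextic_expand shift_simps subst2_nth by algebra
qed

lemma sextic_reverse: "sextic (\<lambda>k. a (6 - k)) = (\<lambda>z. sextic a (subst2 0 1 1 0 z))"
  by (simp add: sextic_expand fun_eq_iff algebra_simps)

lemma sextic_scale:
  "sextic (\<lambda>k. p ^ (6 - k) * q ^ k * a k) = (\<lambda>z. sextic a (subst2 p 0 0 q z))"
  by (simp add: sextic_expand fun_eq_iff algebra_simps power_mult_distrib)

lemma linearly_equivalent_shift: "linearly_equivalent (sextic a) (sextic (shift s a))"
  unfolding sextic_shift by (rule linearly_equivalent_subst2) simp

lemma linearly_equivalent_reverse: "linearly_equivalent (sextic a) (sextic (\<lambda>k. a (6 - k)))"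
  unfolding sextic_reverse by (rule linearly_equivalent_subst2) simp

lemma linearly_equivalent_scale:
  assumes "p \<noteq> 0" "q \<noteq> 0"
  shows "linearly_equivalent (sextic a) (sextic (\<lambda>k. p ^ (6 - k) * q ^ k * a k))"
  unfolding sextic_scale by (rule linearly_equivalent_subst2) (use assms in simp)

section \<open>Eigencubics\<close>

text \<open>
  With \<open>g = \<Sum>k\<le>3. (3 choose k) g\<^sub>k x\<^bsup>3-k\<^esup> y\<^bsup>k\<^esup>\<close> this is the third transvectant
  of a sextic and a cubic, up to a constant factor.
\<close>

definition transvectant :: "(nat \<Rightarrow> complex) \<Rightarrow> (nat \<Rightarrow> complex) \<Rightarrow> nat \<Rightarrow> complex" where
  "transvectant a g k = a k * g 3 - 3 * a (k + 1) * g 2 + 3 * a (k + 2) * g 1 - a (k + 3) * g 0"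

lemma transvectant_simps:
  "transvectant a g 0 = a 0 * g 3 - 3 * a 1 * g 2 + 3 * a 2 * g 1 - a 3 * g 0"
  "transvectant a g 1 = a 1 * g 3 - 3 * a 2 * g 2 + 3 * a 3 * g 1 - a 4 * g 0"
  "transvectant a g 2 = a 2 * g 3 - 3 * a 3 * g 2 + 3 * a 4 * g 1 - a 5 * g 0"
  "transvectant a g 3 = a 3 * g 3 - 3 * a 4 * g 2 + 3 * a 5 * g 1 - a 6 * g 0"
  by (simp_all add: transvectant_def eval_nat_numeral)

definition eigencubic :: "(nat \<Rightarrow> complex) \<Rightarrow> (nat \<Rightarrow> complex) \<Rightarrow> complex \<Rightarrow> bool" where
  "eigencubic a g l \<longleftrightarrow> (\<exists>k\<le>3. g k \<noteq> 0) \<and> (\<forall>k\<le>3. transvectant a g k = l * g k)"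

lemma le_3_iff: "k \<le> 3 \<longleftrightarrow> k = 0 \<or> k = 1 \<or> k = 2 \<or> k = (3::nat)"
  by auto

lemma all_le_3_iff: "(\<forall>k\<le>3. P k) \<longleftrightarrow> P 0 \<and> P 1 \<and> P 2 \<and> P (3::nat)"
  unfolding le_3_iff by blast

lemma ex_le_3_iff: "(\<exists>k\<le>3. P k) \<longleftrightarrow> P 0 \<or> P 1 \<or> P 2 \<or> P (3::nat)"
  unfolding le_3_iff by blast

lemma eigencubic_iff:
  "eigencubic a g l \<longleftrightarrow> (g 0 \<noteq> 0 \<or> g 1 \<noteq> 0 \<or> g 2 \<noteq> 0 \<or> g 3 \<noteq> 0) \<and>
     a 0 * g 3 - 3 * a 1 * g 2 + 3 * a 2 * g 1 - a 3 * g 0 = l * g 0 \<and>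
     a 1 * g 3 - 3 * a 2 * g 2 + 3 * a 3 * g 1 - a 4 * g 0 = l * g 1 \<and>
     a 2 * g 3 - 3 * a 3 * g 2 + 3 * a 4 * g 1 - a 5 * g 0 = l * g 2 \<and>
     a 3 * g 3 - 3 * a 4 * g 2 + 3 * a 5 * g 1 - a 6 * g 0 = l * g 3"
  unfolding eigencubic_def all_le_3_iff ex_le_3_iff transvectant_simps ..

text \<open>
  A substitution of determinant \<open>d\<close> multiplies the transvectant by \<open>d\<^sup>3\<close>. This factor is \<open>1\<close> for shears and
  \<open>- 1\<close> for the exchange of the variables.
\<close>

lemma transvectant_shift:
  assumes "k \<le> 3"
  shows "transvectant (shift s a) (shift s g) k = shift s (transvectant a g) k"
proof -
  consider "k = 0" | "k = 1" | "k = 2" | "k = 3"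
    using assms by linarith
  then show ?thesis
  proof cases
    case 1
    show ?thesis unfolding 1 transvectant_simps shift_simps by algebra
  next
    case 2
    show ?thesis unfolding 2 transvectant_simps shift_simps by algebra
  next
    case 3
    show ?thesis unfolding 3 transvectant_simps shift_simps by algebra
  next
    case 4
    show ?thesis unfolding 4 transvectant_simps shift_simps by algebra
  qed
qed

lemma eigencubic_shift:
  assumes "eigencubic a g l"
  shows "eigencubic (shift s a) (shift s g) l"
proof -
  have "\<exists>k\<le>3. shift s g k \<noteq> 0"
    using assms unfolding eigencubic_iff Bex_def
    by (metis add.right_neutral mult_zero_right le_3_iff shift_simps(1-4))
  moreover have "shift s (transvectant a g) k = l * shift s g k" if "k \<le> 3" for k
    using assms that unfolding eigencubic_def shift_def
    by (auto simp: sum_distrib_left mult_ac intro!: sum.cong)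
  ultimately show ?thesis
    unfolding eigencubic_def by (simp add: transvectant_shift)
qed

lemma transvectant_reverse:
  assumes "k \<le> 3"
  shows "transvectant (\<lambda>k. a (6 - k)) (\<lambda>k. g (3 - k)) k = - transvectant a g (3 - k)"
  using assms unfolding le_3_iff
  by (elim disjE; hypsubst; simp add: transvectant_simps[unfolded One_nat_def])

lemma eigencubic_reverse:
  assumes "eigencubic a g l"
  shows "eigencubic (\<lambda>k. a (6 - k)) (\<lambda>k. g (3 - k)) (- l)"
proof -
  have "\<exists>k\<le>3. g (3 - k) \<noteq> 0"
    using assms unfolding eigencubic_def by (metis diff_diff_cancel diff_le_self)
  then show ?thesis
    using assms unfolding eigencubic_def by (simp add: transvectant_reverse)
qed

lemma eigencubic_scale:
  assumes "eigencubic a g l" "p \<noteq> 0" "q \<noteq> 0"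
  shows "eigencubic (\<lambda>k. p ^ (6 - k) * q ^ k * a k) (\<lambda>k. p ^ (3 - k) * q ^ k * g k) (p ^ 3 * q ^ 3 * l)"
proof -
  have "transvectant (\<lambda>k. p ^ (6 - k) * q ^ k * a k) (\<lambda>k. p ^ (3 - k) * q ^ k * g k) k =
    p ^ 3 * q ^ 3 * (p ^ (3 - k) * q ^ k * transvectant a g k)" if k: "k \<le> 3" for k
  proof -
    consider "k = 0" | "k = 1" | "k = 2" | "k = 3"
      using k by linarith
    then show ?thesis
    proof cases
      case 1
      show ?thesis unfolding 1 transvectant_simps by (simp add: eval_nat_numeral algebra_simps)
    next
      case 2
      show ?thesis unfolding 2 transvectant_simps by (simp add: eval_nat_numeral algebra_simps)
    next
      case 3
      show ?thesis unfolding 3 transvectant_simps by (simp add: eval_nat_numeral algebra_simps)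
    next
      case 4
      show ?thesis unfolding 4 transvectant_simps by (simp add: eval_nat_numeral algebra_simps)
    qed
  qed
  then show ?thesis
    using assms unfolding eigencubic_def by (auto simp: mult.assoc mult.left_commute)
qed

section \<open>Normal forms of eigencubics\<close>

definition cubic_discriminant :: "(nat \<Rightarrow> complex) \<Rightarrow> complex" where
  "cubic_discriminant g = g 0 ^ 2 * g 3 ^ 2 - 6 * g 0 * g 1 * g 2 * g 3 + 4 * g 0 * g 2 ^ 3
     + 4 * g 1 ^ 3 * g 3 - 3 * g 1 ^ 2 * g 2 ^ 2"

lemma cubic_discriminant_shift: "cubic_discriminant (shift s g) = cubic_discriminant g"
  unfolding cubic_discriminant_def shift_simps by algebra

lemma cubic_discriminant_reverse: "cubic_discriminant (\<lambda>k. g (3 - k)) = cubic_discriminant g"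
  by (simp add: cubic_discriminant_def algebra_simps)

lemma ex_root_complex:
  assumes "n > 0"
  shows "\<exists>z::complex. z ^ n = c"
proof (cases "c = 0")
  case True
  then show ?thesis
    using assms by (intro exI[of _ 0]) simp
next
  case False
  then have "exp (ln c / of_nat n) ^ n = c"
    using assms by (simp flip: exp_of_nat_mult)
  then show ?thesis ..
qed

lemma ex_cubic_root:
  assumes "g 0 \<noteq> 0"
  shows "\<exists>s. shift s g 3 = 0"
proof -
  have "\<not> constant (poly [:g 3, 3 * g 2, 3 * g 1, g 0:])"
    using assms by (simp add: constant_degree)
  then obtain s where "poly [:g 3, 3 * g 2, 3 * g 1, g 0:] s = 0"
    using fundamental_theorem_of_algebra by blast
  then have "shift s g 3 = 0"
    unfolding shift_simps by (simp add: algebra_simps power2_eq_square power3_eq_cube)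
  then show ?thesis ..
qed

text \<open>
  A root of the cubic is moved to make it divisible by \<open>y\<close>, and a shear completes the square in the
  other factor. What is left is \<open>y (3 h\<^sub>1 x\<^sup>2 + h\<^sub>3 y\<^sup>2)\<close>, unless \<open>y\<^sup>2\<close> divides the cubic; then a shear and the
  exchange of the variables lead to a multiple of \<open>x\<^sup>2 y\<close> or \<open>x\<^sup>3\<close>.
\<close>

lemma eigencubic_normal_form:
  assumes "eigencubic a g l"
  obtains b h m where "linearly_equivalent (sextic a) (sextic b)" "eigencubic b h m"
    "cubic_discriminant h = cubic_discriminant g"
    "h 0 = 0 \<and> h 1 \<noteq> 0 \<and> h 2 = 0 \<or> h 0 \<noteq> 0 \<and> h 1 = 0 \<and> h 2 = 0 \<and> h 3 = 0"
proof -
  define normal where "normal h \<longleftrightarrow>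
    h 0 = 0 \<and> h 1 \<noteq> 0 \<and> h 2 = 0 \<or> h 0 \<noteq> 0 \<and> h 1 = 0 \<and> h 2 = 0 \<and> h 3 = 0" for h :: "nat \<Rightarrow> complex"
  define Q where "Q g \<longleftrightarrow> (\<forall>a l. eigencubic a g l \<longrightarrow>
    (\<exists>b h m. linearly_equivalent (sextic a) (sextic b) \<and> eigencubic b h m \<and>
       cubic_discriminant h = cubic_discriminant g \<and> normal h))" for g
  have shift: "Q g" if "Q (shift s g)" for g s
    unfolding Q_def
  proof (intro allI impI)
    fix a l
    assume "eigencubic a g l"
    then obtain b h m where "linearly_equivalent (sextic (shift s a)) (sextic b)" "eigencubic b h m"
      "cubic_discriminant h = cubic_discriminant g" "normal h"
      using \<open>Q (shift s g)\<close> eigencubic_shift unfolding Q_def cubic_discriminant_shift by blast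
    then show "\<exists>b h m. linearly_equivalent (sextic a) (sextic b) \<and> eigencubic b h m \<and>
        cubic_discriminant h = cubic_discriminant g \<and> normal h"
      using linearly_equivalent_trans[OF linearly_equivalent_shift] by blast
  qed
  have reverse: "Q g" if "Q (\<lambda>k. g (3 - k))" for g
    unfolding Q_def
  proof (intro allI impI)
    fix a l
    assume "eigencubic a g l"
    then obtain b h m where "linearly_equivalent (sextic (\<lambda>k. a (6 - k))) (sextic b)" "eigencubic b h m"
      "cubic_discriminant h = cubic_discriminant g" "normal h"
      using \<open>Q (\<lambda>k. g (3 - k))\<close> eigencubic_reverse unfolding Q_def cubic_discriminant_reverse by blast
    then show "\<exists>b h m. linearly_equivalent (sextic a) (sextic b) \<and> eigencubic b h m \<and>
        cubic_discriminant h = cubic_discriminant g \<and> normal h"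
      using linearly_equivalent_trans[OF linearly_equivalent_reverse] by blast
  qed
  have normal: "Q g" if "normal g" for g
    using that linearly_equivalent_refl unfolding Q_def by blast
  have divisible: "Q g" if "g 0 = 0" for g
  proof (cases "g 1 = 0")
    case False
    define s where "s = - g 2 / (2 * g 1)"
    have "shift s g 2 = 0"
      unfolding shift_simps using False that by (simp add: s_def field_simps)
    moreover have "shift s g 0 = 0" "shift s g 1 \<noteq> 0"
      unfolding shift_simps using False that by simp_all
    ultimately have "normal (shift s g)"
      unfolding normal_def by blast
    then have "Q (shift s g)"
      by (rule normal)
    then show ?thesis
      by (rule shift)
  next
    case g1: True
    show ?thesis
    proof (cases "g 2 = 0")
      case False
      define s where "s = - g 3 / (3 * g 2)"
      have "shift s g 3 = 0"
        unfolding shift_simps using False that g1 by (simp add: s_def field_simps)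
      moreover have "shift s g 1 = 0" "shift s g 2 \<noteq> 0"
        unfolding shift_simps using False that g1 by simp_all
      ultimately have "normal (\<lambda>k. shift s g (3 - k))"
        using that g1 by (simp add: normal_def shift_simps(1))
      then have "Q (\<lambda>k. shift s g (3 - k))"
        by (rule normal)
      then show ?thesis
        using shift reverse by blast
    next
      case g2: True
      show ?thesis
      proof (cases "g 3 = 0")
        case False
        then have "normal (\<lambda>k. g (3 - k))"
          using g1 g2 that by (simp add: normal_def)
        then show ?thesis
          by (intro reverse[of g] normal)
      next
        case True
        then show ?thesis
          using g1 g2 that unfolding Q_def eigencubic_iff by blast
      qed
    qed
  qed
  have "Q g"
  proof (cases "g 0 = 0")
    case False
    then obtain s where "shift s g 3 = 0"
      using ex_cubic_root by blast
    then have "Q (\<lambda>k. shift s g (3 - k))"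
      by (intro divisible) simp
    then show ?thesis
      using shift reverse by blast
  qed (rule divisible)
  then show thesis
    using assms that unfolding Q_def normal_def by blast
qed

section \<open>Reduction to Sylvester canonical form\<close>

definition sylvester_reducible :: "(complex^2 \<Rightarrow> complex) \<Rightarrow> bool" where
  "sylvester_reducible f \<longleftrightarrow> (\<exists>g. sylvester_canonical g \<and> linearly_equivalent f g)"

lemma sylvester_reducible_linearly_equivalent:
  assumes "linearly_equivalent f g" "sylvester_reducible g"
  shows "sylvester_reducible f"
  using assms linearly_equivalent_trans unfolding sylvester_reducible_def by blast

lemma linear_form: "(\<lambda>z. p * z $ 1 + q * z $ 2) \<in> linear_forms"
  unfolding binary_forms_def form_of_def
  by (rule range_eqI[of _ _ "\<lambda>k. if k = 0 then p else q"]) (simp add: fun_eq_iff)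

lemma lin_indep2_linear_forms:
  assumes "p * s - q * r \<noteq> 0"
  shows "lin_indep2 (\<lambda>z. p * z $ 1 + q * z $ 2) (\<lambda>z. r * z $ 1 + s * z $ 2)"
  unfolding lin_indep2_def
proof (intro allI impI)
  fix x y :: complex
  assume *: "\<forall>z::complex^2. x * (p * z $ 1 + q * z $ 2) + y * (r * z $ 1 + s * z $ 2) = 0"
  have "x * p + y * r = 0" "x * q + y * s = 0"
    using spec[OF *, of "vector [1, 0]"] spec[OF *, of "vector [0, 1]"] by simp_all
  then have "x * (p * s - q * r) = 0" "y * (p * s - q * r) = 0"
    by algebra+
  then show "x = 0 \<and> y = 0"
    using assms by simp
qed

text \<open>
  For \<open>3y(x - y)(x + y)\<close> the eigenvector equation leaves \<open>a\<^sub>0\<close>, \<open>a\<^sub>3\<close>, \<open>a\<^sub>6\<close> and the eigenvalue free. With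
  \<open>u = 2y\<close>, \<open>v = x - y\<close>, \<open>w = - x - y\<close> these four parameters are matched by the four coefficients of a
  Sylvester canonical form.
\<close>

lemma sylvester_canonical_if_eigencubic:
  assumes "eigencubic a h l" "h 0 = 0" "h 1 = 1" "h 2 = 0" "h 3 = - 3"
  shows "sylvester_canonical (sextic a)"
proof -
  have a: "a 2 = a 0" "a 4 = a 0" "3 * a 3 - 3 * a 1 = l" "l * 3 + 3 * a 5 = 3 * a 3"
    using assms unfolding eigencubic_iff by (simp_all add: algebra_simps)
  \<comment> \<open>The eigenvalue fixes the coefficient \<open>l / 8\<close> of the product; comparing the coefficients of
    \<open>x\<^sup>6\<close>, \<open>x\<^sup>3 y\<^sup>3\<close> and \<open>y\<^sup>6\<close> then gives the others.\<close>
  define A where "A = (a 6 - a 0) / 64"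
  define B where "B = (a 0 - a 3 + l / 4) / 2"
  define C where "C = (a 0 + a 3 - l / 4) / 2"
  define u v w where "u = (\<lambda>z::complex^2. 0 * z $ 1 + 2 * z $ 2)"
    and "v = (\<lambda>z::complex^2. 1 * z $ 1 + - 1 * z $ 2)"
    and "w = (\<lambda>z::complex^2. - 1 * z $ 1 + - 1 * z $ 2)"
  have "u \<in> linear_forms" "v \<in> linear_forms" "w \<in> linear_forms"
    unfolding u_def v_def w_def by (rule linear_form)+
  moreover have "lin_indep2 u v" "lin_indep2 v w" "lin_indep2 u w"
    unfolding u_def v_def w_def by (rule lin_indep2_linear_forms; simp)+
  moreover have "\<forall>z. u z + v z + w z = 0"
    by (simp add: u_def v_def w_def)
  moreover have "sextic a = (\<lambda>z. A * u z ^ 6 + B * v z ^ 6 + C * w z ^ 6 +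
     l / 8 * (u z * v z * w z * (u z - v z) * (v z - w z) * (w z - u z)))"
  proof
    fix z
    have "64 * A = a 6 - a 0" "8 * B = 4 * a 0 - 4 * a 3 + l" "8 * C = 4 * a 0 + 4 * a 3 - l"
      by (simp_all add: A_def B_def C_def)
    then have "8 * sextic a z = 8 * (A * u z ^ 6 + B * v z ^ 6 + C * w z ^ 6) +
      l * (u z * v z * w z * (u z - v z) * (v z - w z) * (w z - u z))"
      using a unfolding sextic_expand u_def v_def w_def by algebra
    then show "sextic a z = A * u z ^ 6 + B * v z ^ 6 + C * w z ^ 6 +
      l / 8 * (u z * v z * w z * (u z - v z) * (v z - w z) * (w z - u z))"
      by (simp add: field_simps)
  qed
  ultimately show ?thesis
    unfolding sylvester_canonical_def by blast
qed

text \<open>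
  The normal form of a cubic with three distinct factors still has a free coefficient, which is
  scaled away to reach the eigencubic \<open>3y(x - y)(x + y)\<close>.
\<close>

theorem sylvester_reducible_if_eigencubic:
  assumes "eigencubic a g l" "cubic_discriminant g \<noteq> 0"
  shows "sylvester_reducible (sextic a)"
proof -
  obtain b h m where b: "linearly_equivalent (sextic a) (sextic b)" "eigencubic b h m"
    "cubic_discriminant h = cubic_discriminant g"
    "h 0 = 0 \<and> h 1 \<noteq> 0 \<and> h 2 = 0 \<or> h 0 \<noteq> 0 \<and> h 1 = 0 \<and> h 2 = 0 \<and> h 3 = 0"
    using eigencubic_normal_form[OF assms(1)] by metis
  then have h: "h 0 = 0" "h 1 \<noteq> 0" "h 2 = 0" "h 3 \<noteq> 0"
    using assms(2) by (auto simp: cubic_discriminant_def)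
  obtain q where q: "q ^ 3 = - 3 / h 3"
    using ex_root_complex[of 3] by auto
  obtain p where p: "p ^ 2 = 1 / (h 1 * q)"
    using ex_root_complex[of 2] by auto
  have nz: "q \<noteq> 0" "p \<noteq> 0"
    using p q h by auto
  let ?c = "\<lambda>k. p ^ (6 - k) * q ^ k * b k" and ?h = "\<lambda>k. p ^ (3 - k) * q ^ k * h k"
  have "eigencubic ?c ?h (p ^ 3 * q ^ 3 * m)"
    using b nz by (intro eigencubic_scale)
  moreover have "?h 0 = 0" "?h 1 = 1" "?h 2 = 0" "?h 3 = -3"
    using h p q nz by (simp_all add: field_simps)
  ultimately have "sylvester_canonical (sextic ?c)"
    using sylvester_canonical_if_eigencubic by blast
  moreover have "linearly_equivalent (sextic a) (sextic ?c)"
    using b(1) linearly_equivalent_scale[OF nz(2,1)] linearly_equivalent_trans by blast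
  ultimately show ?thesis
    unfolding sylvester_reducible_def by blast
qed

text \<open>
  A cubic with a repeated factor becomes a multiple of \<open>x\<^sup>2 y\<close> or \<open>x\<^sup>3\<close>. Up to a factor, their transvectants have
  the coefficients \<open>a\<^sub>2, \<dots>, a\<^sub>5\<close> and \<open>a\<^sub>3, \<dots>, a\<^sub>6\<close>, of which all but the one of the eigencubic itself must vanish.
\<close>

theorem degenerate_eigencubic:
  assumes "eigencubic a g l" "cubic_discriminant g = 0"
  obtains b where "linearly_equivalent (sextic a) (sextic b)"
    "b 2 = 0 \<and> b 4 = 0 \<and> b 5 = 0 \<or> b 4 = 0 \<and> b 5 = 0 \<and> b 6 = 0"
proof -
  obtain b h m where b: "linearly_equivalent (sextic a) (sextic b)" "eigencubic b h m"
    "cubic_discriminant h = cubic_discriminant g"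
    "h 0 = 0 \<and> h 1 \<noteq> 0 \<and> h 2 = 0 \<or> h 0 \<noteq> 0 \<and> h 1 = 0 \<and> h 2 = 0 \<and> h 3 = 0"
    using eigencubic_normal_form[OF assms(1)] by metis
  have "b 2 = 0 \<and> b 4 = 0 \<and> b 5 = 0 \<or> b 4 = 0 \<and> b 5 = 0 \<and> b 6 = 0"
    using b(4)
  proof
    assume h: "h 0 = 0 \<and> h 1 \<noteq> 0 \<and> h 2 = 0"
    then have "h 3 = 0"
      using b(3) assms(2) by (simp add: cubic_discriminant_def)
    then show ?thesis
      using h b(2) unfolding eigencubic_iff by simp
  next
    assume h: "h 0 \<noteq> 0 \<and> h 1 = 0 \<and> h 2 = 0 \<and> h 3 = 0"
    then show ?thesis
      using b(2) unfolding eigencubic_iff by simp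
  qed
  then show thesis
    using b(1) that by blast
qed

section \<open>Existence of eigencubics\<close>

lemma transvectant_linear:
  "transvectant a (\<lambda>k. x * g k + y * h k) k = x * transvectant a g k + y * transvectant a h k"
  unfolding transvectant_def by (simp add: algebra_simps)

definition quadratic_invariant :: "(nat \<Rightarrow> complex) \<Rightarrow> complex" where
  "quadratic_invariant a = a 0 * a 6 - 6 * a 1 * a 5 + 15 * a 2 * a 4 - 10 * (a 3) ^ 2"

text \<open>
  The determinant of the Hankel matrix \<open>a\<^bsub>i+j\<^esub>\<close> with \<open>i, j \<le> 3\<close>, expanded along the first row.
\<close>

definition catalecticant :: "(nat \<Rightarrow> complex) \<Rightarrow> complex" where
  "catalecticant a =
     a 0 * (a 2 * (a 4 * a 6 - (a 5) ^ 2) - a 3 * (a 3 * a 6 - a 4 * a 5) + a 4 * (a 3 * a 5 - (a 4) ^ 2))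
   - a 1 * (a 1 * (a 4 * a 6 - (a 5) ^ 2) - a 3 * (a 2 * a 6 - a 3 * a 5) + a 4 * (a 2 * a 5 - a 3 * a 4))
   + a 2 * (a 1 * (a 3 * a 6 - a 4 * a 5) - a 2 * (a 2 * a 6 - a 3 * a 5) + a 4 * (a 2 * a 4 - (a 3) ^ 2))
   - a 3 * (a 1 * (a 3 * a 5 - (a 4) ^ 2) - a 2 * (a 2 * a 5 - a 3 * a 4) + a 3 * (a 2 * a 4 - (a 3) ^ 2))"

text \<open>
  The operator is skew for the invariant symplectic form on cubics, hence its characteristic
  polynomial is even. Its matrix is the Hankel matrix times an antidiagonal matrix
  of determinant 9.
\<close>

lemma transvectant_cayley_hamilton:
  fixes a g :: "nat \<Rightarrow> complex"
  assumes "k \<le> 3"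
  defines "T \<equiv> transvectant a"
  shows "T (T (T (T g))) k + quadratic_invariant a * T (T g) k + 9 * catalecticant a * g k = 0"
proof -
  consider "k = 0" | "k = 1" | "k = 2" | "k = 3"
    using assms(1) by linarith
  then show ?thesis
  proof cases
    case 1
    show ?thesis
      unfolding 1 T_def transvectant_simps quadratic_invariant_def catalecticant_def by algebra
  next
    case 2
    show ?thesis
      unfolding 2 T_def transvectant_simps quadratic_invariant_def catalecticant_def by algebra
  next
    case 3
    show ?thesis
      unfolding 3 T_def transvectant_simps quadratic_invariant_def catalecticant_def by algebra
  next
    case 4
    show ?thesis
      unfolding 4 T_def transvectant_simps quadratic_invariant_def catalecticant_def by algebra
  qed
qed

text \<open>
  Since the characteristic polynomial is even, it factors explicitly as
  \<open>(\<lambda> - x)(\<lambda> + x)(\<lambda> - y)(\<lambda> + y)\<close> for numbers \<open>x\<close> and \<open>y\<close>. Apply the four factors in turn to some nonzero cubic: the result is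
  zero, so the last nonzero cubic on the way is an eigenvector.
\<close>

theorem ex_eigencubic: "\<exists>g l. eigencubic a g l"
proof -
  define T where "T = transvectant a"
  define N where "N l g = (\<lambda>k. 1 * T g k + l * g k)" for l g
  have T_cong: "T g k = T h k" if "\<And>k. k \<le> 3 \<Longrightarrow> g k = h k" for g h k
    using that unfolding T_def transvectant_def by simp
  define t where "t = (csqrt (quadratic_invariant a ^ 2 - 36 * catalecticant a) - quadratic_invariant a) / 2"
  define x where "x = csqrt t"
  define y where "y = csqrt (- quadratic_invariant a - t)"
  have xy: "x ^ 2 + y ^ 2 = - quadratic_invariant a" "x ^ 2 * y ^ 2 = 9 * catalecticant a"
  proof -
    show "x ^ 2 + y ^ 2 = - quadratic_invariant a"
      by (simp add: x_def y_def)
    have "2 * t + quadratic_invariant a = csqrt (quadratic_invariant a ^ 2 - 36 * catalecticant a)"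
      by (simp add: t_def field_simps)
    then have "(2 * t + quadratic_invariant a) ^ 2 = quadratic_invariant a ^ 2 - 36 * catalecticant a"
      by simp
    then have "t * (- quadratic_invariant a - t) = 9 * catalecticant a"
      by algebra
    then show "x ^ 2 * y ^ 2 = 9 * catalecticant a"
      by (simp add: x_def y_def)
  qed
  have NN: "N l (N (- l) g) k = T (T g) k - l ^ 2 * g k" for l g k
    unfolding N_def T_def transvectant_linear by algebra
  have TT: "T (T (N l (N (- l) g))) k = T (T (T (T g))) k - l ^ 2 * T (T g) k" for l g k
  proof -
    have *: "N l (N (- l) g) = (\<lambda>k. 1 * T (T g) k + (- (l ^ 2)) * g k)"
      by (rule ext) (simp add: NN)
    have **: "T (N l (N (- l) g)) = (\<lambda>k. 1 * T (T (T g)) k + (- (l ^ 2)) * T g k)"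
      unfolding * unfolding T_def by (rule ext, rule transvectant_linear)
    show ?thesis
      unfolding ** unfolding T_def transvectant_linear by simp
  qed
  have zero: "N x (N (- x) (N y (N (- y) g))) k = 0" if "k \<le> 3" for g k
  proof -
    have "N x (N (- x) (N y (N (- y) g))) k
      = T (T (T (T g))) k - (x ^ 2 + y ^ 2) * T (T g) k + x ^ 2 * y ^ 2 * g k"
      unfolding NN[of x] TT NN[of y] by algebra
    then show ?thesis
      using transvectant_cayley_hamilton[OF that, of a g] unfolding xy T_def by simp
  qed
  define nz where "nz g \<longleftrightarrow> (\<exists>k\<le>3. g k \<noteq> 0)" for g :: "nat \<Rightarrow> complex"
  have step: "nz (N l g) \<or> eigencubic a g (- l)" if "nz g" for l g
    using that unfolding nz_def eigencubic_def N_def T_def by (auto simp: add_eq_0_iff2)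
  have "nz (\<lambda>k. 1)"
    by (auto simp: nz_def)
  moreover have "\<not> nz (N x (N (- x) (N y (N (- y) (\<lambda>k. 1)))))"
    using zero by (auto simp: nz_def)
  ultimately show ?thesis
    using step by meson
qed

text \<open>
  Up to sign, \<open>d\<close> is the determinant of the substitution.
\<close>

lemma invariants_linearly_equivalent:
  assumes "linearly_equivalent (sextic a) (sextic b)"
  obtains d where "d \<noteq> 0" "quadratic_invariant b = d ^ 6 * quadratic_invariant a"
    "catalecticant b = d ^ 12 * catalecticant a"
proof -
  define R where "R f \<longleftrightarrow> (\<exists>b d. f = sextic b \<and> d \<noteq> 0 \<and>
    quadratic_invariant b = d ^ 6 * quadratic_invariant a \<and>
    catalecticant b = d ^ 12 * catalecticant a)" for f
  have "R (sextic b)"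
    using assms
  proof (rule linearly_equivalent_induct[where R = R])
    show "R (sextic a)"
      unfolding R_def by (intro exI[of _ a] exI[of _ 1]) simp
  next
    fix h s
    assume "R h"
    then obtain b d where b: "h = sextic b" "d \<noteq> 0"
      "quadratic_invariant b = d ^ 6 * quadratic_invariant a"
      "catalecticant b = d ^ 12 * catalecticant a"
      by (auto simp: R_def)
    have "quadratic_invariant (shift s b) = quadratic_invariant b"
      unfolding quadratic_invariant_def shift_simps by algebra
    moreover have "catalecticant (shift s b) = catalecticant b"
      unfolding catalecticant_def shift_simps by algebra
    ultimately show "R (\<lambda>z. h (subst2 1 s 0 1 z))"
      unfolding R_def using b by (intro exI[of _ "shift s b"] exI[of _ d]) (simp add: sextic_shift)
  next
    fix h
    assume "R h"
    then obtain b d where b: "h = sextic b" "d \<noteq> 0"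
      "quadratic_invariant b = d ^ 6 * quadratic_invariant a"
      "catalecticant b = d ^ 12 * catalecticant a"
      by (auto simp: R_def)
    have "quadratic_invariant (\<lambda>k. b (6 - k)) = quadratic_invariant b"
      unfolding quadratic_invariant_def by simp
    moreover have "catalecticant (\<lambda>k. b (6 - k)) = catalecticant b"
      unfolding catalecticant_def by (simp, algebra)
    ultimately show "R (\<lambda>z. h (subst2 0 1 1 0 z))"
      unfolding R_def using b by (intro exI[of _ "\<lambda>k. b (6 - k)"] exI[of _ d]) (simp add: sextic_reverse)
  next
    fix h and p q :: complex
    assume "R h" and pq: "p \<noteq> 0" "q \<noteq> 0"
    then obtain b d where b: "h = sextic b" "d \<noteq> 0"
      "quadratic_invariant b = d ^ 6 * quadratic_invariant a"
      "catalecticant b = d ^ 12 * catalecticant a"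
      by (auto simp: R_def)
    let ?b = "\<lambda>k. p ^ (6 - k) * q ^ k * b k"
    have "quadratic_invariant ?b = (p * q) ^ 6 * quadratic_invariant b"
      unfolding quadratic_invariant_def by (simp, algebra)
    moreover have "catalecticant ?b = (p * q) ^ 12 * catalecticant b"
      unfolding catalecticant_def by (simp, algebra)
    ultimately show "R (\<lambda>z. h (subst2 p 0 0 q z))"
      unfolding R_def using b pq
      by (intro exI[of _ ?b] exI[of _ "p * q * d"]) (simp add: sextic_scale power_mult_distrib)
  qed
  then obtain c d where c: "sextic b = sextic c" "d \<noteq> 0"
      "quadratic_invariant c = d ^ 6 * quadratic_invariant a"
      "catalecticant c = d ^ 12 * catalecticant a"
    by (auto simp: R_def)
  have "b k = c k" if "k \<le> 6" for k
    using sextic_eqD[OF c(1) that] .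
  then have "quadratic_invariant b = quadratic_invariant c" "catalecticant b = catalecticant c"
    by (simp_all add: quadratic_invariant_def catalecticant_def)
  then show thesis
    using c that by simp
qed

text \<open>
  The form in which Sylvester reducibility is used from here on: for a sextic that is not reducible, each
  explicit eigencubic yields an equation between the coefficients.
\<close>

lemma discriminant_eq_0_if_not_reducible:
  assumes irred: "\<not> sylvester_reducible (sextic a)"
    and "a 0 * g3 - 3 * a 1 * g2 + 3 * a 2 * g1 - a 3 * g0 = l * g0"
    "a 1 * g3 - 3 * a 2 * g2 + 3 * a 3 * g1 - a 4 * g0 = l * g1"
    "a 2 * g3 - 3 * a 3 * g2 + 3 * a 4 * g1 - a 5 * g0 = l * g2"
    "a 3 * g3 - 3 * a 4 * g2 + 3 * a 5 * g1 - a 6 * g0 = l * g3"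
  shows "g0 ^ 2 * g3 ^ 2 - 6 * g0 * g1 * g2 * g3 + 4 * g0 * g2 ^ 3 + 4 * g1 ^ 3 * g3
      - 3 * g1 ^ 2 * g2 ^ 2 = 0"
proof (rule ccontr)
  assume nz: "\<not> ?thesis"
  define g where "g = (\<lambda>k::nat. [g0, g1, g2, g3] ! k)"
  have g: "g 0 = g0" "g 1 = g1" "g 2 = g2" "g 3 = g3"
    by (simp_all add: g_def eval_nat_numeral)
  have "g0 \<noteq> 0 \<or> g1 \<noteq> 0 \<or> g2 \<noteq> 0 \<or> g3 \<noteq> 0"
    using nz by auto
  then have "eigencubic a g l"
    unfolding eigencubic_iff g using assms(2-5) by blast
  moreover have "cubic_discriminant g \<noteq> 0"
    unfolding cubic_discriminant_def g by (fact nz)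
  ultimately show False
    using irred sylvester_reducible_if_eigencubic by blast
qed

lemma depressed_discriminant_eq_0_if_not_reducible:
  assumes irred: "\<not> sylvester_reducible (sextic a)"
    and "a 0 * g3 + 3 * a 2 * g1 - a 3 * g0 = l * g0"
    "a 1 * g3 + 3 * a 3 * g1 - a 4 * g0 = l * g1"
    "a 2 * g3 + 3 * a 4 * g1 - a 5 * g0 = 0"
    "a 3 * g3 + 3 * a 5 * g1 - a 6 * g0 = l * g3"
  shows "g3 * (g0 ^ 2 * g3 + 4 * g1 ^ 3) = 0"
  using discriminant_eq_0_if_not_reducible[OF irred, of g3 0 g1 g0 l] assms
  by (simp add: algebra_simps power2_eq_square)

section \<open>Sextics with the eigencubic \<open>x\<^sup>2 y\<close>\<close>

text \<open>
  The forms in question are \<open>a\<^sub>0 x\<^sup>6 + 6 a\<^sub>1 x\<^sup>5 y + 20 a\<^sub>3 x\<^sup>3 y\<^sup>3 + a\<^sub>6 y\<^sup>6\<close>. On them the rescalings of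
  \<open>x\<close> and \<open>y\<close> have the invariants \<open>a\<^sub>0 a\<^sub>6 / a\<^sub>3\<^sup>2\<close> and \<open>a\<^sub>1\<^sup>3 a\<^sub>6\<^sup>2 / a\<^sub>3\<^sup>5\<close>, and these suffice.
\<close>

lemma linearly_equivalent_by_scaling:
  assumes "a 2 = 0" "a 4 = 0" "a 5 = 0" "b 2 = 0" "b 4 = 0" "b 5 = 0"
    and nz: "a 3 \<noteq> 0" "a 6 \<noteq> 0" "b 1 \<noteq> 0" "b 3 \<noteq> 0" "b 6 \<noteq> 0"
    and inv0: "a 0 * a 6 * b 3 ^ 2 = b 0 * b 6 * a 3 ^ 2"
    and inv1: "a 1 ^ 3 * a 6 ^ 2 * b 3 ^ 5 = b 1 ^ 3 * b 6 ^ 2 * a 3 ^ 5"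
  shows "linearly_equivalent (sextic a) (sextic b)"
proof -
  obtain q where q: "q ^ 6 = b 6 / a 6"
    using ex_root_complex[of 6] by auto
  have "q \<noteq> 0"
    using q nz by auto
  obtain p where p: "p ^ 3 = b 3 / (a 3 * q ^ 3)"
    using ex_root_complex[of 3] by auto
  have "p \<noteq> 0"
    using p nz \<open>q \<noteq> 0\<close> by auto
  have a6: "q ^ 6 * a 6 = b 6" and a3: "p ^ 3 * q ^ 3 * a 3 = b 3"
    using p q nz \<open>q \<noteq> 0\<close> by (simp_all add: field_simps)
  have "p ^ 6 * a 0 * (a 6 * b 3 ^ 2) = b 0 * (a 6 * b 3 ^ 2)"
    using inv0 a6 a3 by algebra
  then have a0: "p ^ 6 * a 0 = b 0"
    using nz by simp
  have "(p ^ 5 * q * a 1) ^ 3 * (a 6 ^ 2 * q ^ 12 * b 3 ^ 5) = b 1 ^ 3 * (a 6 ^ 2 * q ^ 12 * b 3 ^ 5)"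
    using inv1 a6 a3 by algebra
  then have "(p ^ 5 * q * a 1) ^ 3 = b 1 ^ 3"
    using nz \<open>q \<noteq> 0\<close> by simp
  \<comment> \<open>The cube of \<open>a\<^sub>1\<close> is matched, so \<open>a\<^sub>1\<close> itself is off by a cube root of unity. Multiplying \<open>p\<close> by it
    corrects this and changes neither \<open>p\<^sup>3\<close> nor \<open>p\<^sup>6\<close>.\<close>
  define w where "w = p ^ 5 * q * a 1 / b 1"
  have w: "w ^ 3 = 1" "w * b 1 = p ^ 5 * q * a 1"
    using \<open>(p ^ 5 * q * a 1) ^ 3 = b 1 ^ 3\<close> nz by (simp_all add: w_def field_simps)
  then have "w \<noteq> 0"
    by auto
  have a1: "(p * w) ^ 5 * q * a 1 = b 1"
    using w by algebra
  have "(p * w) ^ 6 * a 0 = b 0" "(p * w) ^ 3 * q ^ 3 * a 3 = b 3"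
    using w(1) a0 a3 by algebra+
  then have "sextic (\<lambda>k. (p * w) ^ (6 - k) * q ^ k * a k) = sextic b"
    using assms(1-6) a1 a6 by (simp add: sextic_expand fun_eq_iff)
  then show ?thesis
    using linearly_equivalent_scale[of "p * w" q a] \<open>p \<noteq> 0\<close> \<open>q \<noteq> 0\<close> \<open>w \<noteq> 0\<close> by simp
qed

text \<open>
  The operator has the eigenvalues \<open>3\<close> (with \<open>x\<^sup>2 y\<close>), \<open>- 3\<close> and the two square roots of \<open>m\<close>. Vanishing
  of the discriminants for both square roots expresses \<open>P\<close> in two ways as a polynomial in them; the even part
  gives \<open>P\<close> and the odd part gives the equation for \<open>m\<close>. The eigenvalue \<open>- 3\<close> rules out \<open>m = 0\<close>. If
  \<open>m = 9\<close>, then \<open>3\<close> and \<open>- 3\<close> are the only eigenvalues, and the latter gives \<open>P\<close>.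
\<close>

lemma double_root_form_parameters:
  assumes zero: "a 2 = 0" "a 4 = 0" "a 5 = 0" and a3: "a 3 = 1" and a6: "a 6 \<noteq> 0"
    and irred: "\<not> sylvester_reducible (sextic a)"
  defines "m \<equiv> 1 - a 0 * a 6" and "P \<equiv> a 1 ^ 3 * a 6 ^ 2"
  shows "m = 9 \<and> P = 864 \<or> m ^ 2 + 46 * m + 81 = 0 \<and> P = - 216 - 104 * m"
proof (cases "m = 9")
  case True
  moreover have "a 0 * a 6 = 1 - m"
    by (simp add: m_def)
  ultimately have m: "a 0 * a 6 = - 8"
    by simp
  have "6 * a 6 * (24 ^ 2 * (6 * a 6) + 4 * (- (a 1 * a 6)) ^ 3) = 0"
    by (rule depressed_discriminant_eq_0_if_not_reducible[OF irred, where l = "- 3"])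
      (use m in \<open>simp_all add: zero a3 field_simps\<close>)
  moreover have "6 * a 6 * (24 ^ 2 * (6 * a 6) + 4 * (- (a 1 * a 6)) ^ 3) = 24 * (a 6 ^ 2 * (864 - P))"
    unfolding P_def by (simp add: algebra_simps eval_nat_numeral)
  ultimately have "24 * (a 6 ^ 2 * (864 - P)) = 0"
    by metis
  then have "P = 864"
    using a6 by simp
  then show ?thesis
    using True by simp
next
  case False
  define u where "u = csqrt m"
  have u: "u ^ 2 = m"
    by (simp add: u_def)
  then have "u \<noteq> 3" "u \<noteq> - 3"
    using False by auto
  have m: "a 0 * a 6 = 1 - m"
    by (simp add: m_def)
  have eig: "4 * P = (1 - v) ^ 2 * (3 - v) ^ 3" if v: "v ^ 2 = m" "v \<noteq> 3" for v
  proof -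
    \<comment> \<open>The eigencubic for the eigenvalue \<open>v\<close>, multiplied by \<open>v - 3\<close> to clear the denominator.\<close>
    have "a 6 * (v - 3) * (((1 - v) * (v - 3)) ^ 2 * (a 6 * (v - 3)) + 4 * (a 1 * a 6) ^ 3) = 0"
    proof (rule depressed_discriminant_eq_0_if_not_reducible[OF irred, where l = v])
      show "a 0 * (a 6 * (v - 3)) + 3 * a 2 * (a 1 * a 6) - a 3 * ((1 - v) * (v - 3)) =
        v * ((1 - v) * (v - 3))"
        using m v(1) zero a3 by algebra
      show "a 1 * (a 6 * (v - 3)) + 3 * a 3 * (a 1 * a 6) - a 4 * ((1 - v) * (v - 3)) = v * (a 1 * a 6)"
        using zero a3 by algebra
      show "a 2 * (a 6 * (v - 3)) + 3 * a 4 * (a 1 * a 6) - a 5 * ((1 - v) * (v - 3)) = 0"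
        using zero by simp
      show "a 3 * (a 6 * (v - 3)) + 3 * a 5 * (a 1 * a 6) - a 6 * ((1 - v) * (v - 3)) =
        v * (a 6 * (v - 3))"
        using zero a3 by algebra
    qed
    then have "(a 6 ^ 2 * (v - 3)) * (4 * P) = (a 6 ^ 2 * (v - 3)) * ((1 - v) ^ 2 * (3 - v) ^ 3)"
      unfolding P_def by algebra
    then show ?thesis
      using a6 v by simp
  qed
  have "4 * P = (1 - u) ^ 2 * (3 - u) ^ 3" "4 * P = (1 + u) ^ 2 * (3 + u) ^ 3"
    using eig[of u] eig[of "- u"] u \<open>u \<noteq> 3\<close> \<open>u \<noteq> - 3\<close>
    by (auto simp: add.commute minus_equation_iff[of u])
  then have P: "4 * P = 27 + 90 * m + 11 * m ^ 2" and "u * (m ^ 2 + 46 * m + 81) = 0"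
    using u by algebra+
  then consider "m = 0" | "m ^ 2 + 46 * m + 81 = 0"
    using u by auto
  then show ?thesis
  proof cases
    case 1
    let ?d = "9 - m"
    \<comment> \<open>The eigencubic for the eigenvalue \<open>- 3\<close>.\<close>
    have "(24 * a 1) ^ 2 * (6 * a 1 * a 6) ^ 2 - 6 * (24 * a 1) * (- (a 1 ^ 2 * a 6)) * (2 * ?d) * (6 * a 1 * a 6)
      + 4 * (24 * a 1) * (2 * ?d) ^ 3 + 4 * (- (a 1 ^ 2 * a 6)) ^ 3 * (6 * a 1 * a 6)
      - 3 * (- (a 1 ^ 2 * a 6)) ^ 2 * (2 * ?d) ^ 2 = 0" (is "?disc = 0")
    proof (rule discriminant_eq_0_if_not_reducible[OF irred, where l = "- 3"])
      show "a 0 * (6 * a 1 * a 6) - 3 * a 1 * (2 * ?d) + 3 * a 2 * (- (a 1 ^ 2 * a 6)) - a 3 * (24 * a 1) =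
        - 3 * (24 * a 1)"
        using m zero a3 by algebra
      show "a 1 * (6 * a 1 * a 6) - 3 * a 2 * (2 * ?d) + 3 * a 3 * (- (a 1 ^ 2 * a 6)) - a 4 * (24 * a 1) =
        - 3 * (- (a 1 ^ 2 * a 6))"
        using zero a3 by algebra
      show "a 2 * (6 * a 1 * a 6) - 3 * a 3 * (2 * ?d) + 3 * a 4 * (- (a 1 ^ 2 * a 6)) - a 5 * (24 * a 1) =
        - 3 * (2 * ?d)"
        using zero a3 by algebra
      show "a 3 * (6 * a 1 * a 6) - 3 * a 4 * (2 * ?d) + 3 * a 5 * (- (a 1 ^ 2 * a 6)) - a 6 * (24 * a 1) =
        - 3 * (6 * a 1 * a 6)"
        using zero a3 by algebra
    qed
    moreover have "?disc = - 12 * (a 1 * (P * ?d ^ 2 - 64 * ?d ^ 3 + 2 * P ^ 2 - 1728 * P - 144 * ?d * P))"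
      unfolding P_def by algebra
    ultimately have "- 12 * (a 1 * (P * ?d ^ 2 - 64 * ?d ^ 3 + 2 * P ^ 2 - 1728 * P - 144 * ?d * P)) = 0"
      by metis
    moreover have "4 * P = 27"
      using P 1 by simp
    then have "a 1 \<noteq> 0" and "P = 27 / 4"
      by (auto simp: P_def field_simps)
    ultimately show ?thesis
      using 1 by (simp add: power_divide)
  next
    case 2
    then have "P = - 216 - 104 * m"
      using P by algebra
    then show ?thesis
      using 2 by simp
  qed
qed

definition listed_coeffs :: "nat \<Rightarrow> nat \<Rightarrow> complex" where
  "listed_coeffs i k = ([
     [0, 0, 1 / 15, 0, 0, 0, 0],
     [1, 0, 1 / 15, 0, 0, 0, 0],
     [0, 0, 0, 1 / 20, 0, 0, 0],
     [0, 1 / 6, 0, 0, 0, 0, 0],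
     [1, 0, 0, 0, 0, 1 / 6, 0],
     [2, 3, 0, 1 / 2, 0, 0, - 1],
     [184, - 32, - 20, - 16, - 10, - 8, 23]] ! i) ! k"

lemma exceptional_list_eq_sextic:
  "exceptional_list = map (\<lambda>i. sextic (listed_coeffs i)) [0, 1, 2, 3, 4, 5, 6]"
  unfolding exceptional_list_def
  by (simp add: sextic_expand fun_eq_iff listed_coeffs_def) (simp add: eval_nat_numeral algebra_simps)

text \<open>
  Here \<open>n = 4 \<plusminus> \<surd>7\<close>. The eigencubics of the last form are defined over the field generated by \<open>n\<close> and \<open>t\<close>,
  and one of them is a product \<open>X\<^sup>2 Y\<close> of linear forms over that field. The substitution expresses the variables
  through \<open>X\<close> and \<open>Y\<close>, which brings the sextic into the form of this section.
\<close>

lemma listed_6_double_root_form: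
  fixes n t :: complex
  assumes n: "n ^ 2 = 8 * n - 9" and t: "126 * t ^ 2 = 4 * n - 23"
  shows "linearly_equivalent (sextic (listed_coeffs 6)) (\<lambda>z.
    (- 12662496 + 9350208 * n + 75089952 * t - 55447616 * n * t) * (z $ 1) ^ 6 +
    6 * (- 2119320 + 1564808 * n + 12566736 * t - 9279424 * n * t) * (z $ 1) ^ 5 * z $ 2 +
    20 * (- 29232 + 20440 * n + 165816 * t - 122696 * n * t) * (z $ 1) ^ 3 * (z $ 2) ^ 3 +
    (- 2390976 + 1830976 * n - 15382080 * t + 11019904 * n * t) * (z $ 2) ^ 6)"
  (is "linearly_equivalent _ ?f")
proof -
  define p q where "p = n - 2 - t * (5 * n - 6)" and "q = n - 3 + t * (4 * n - 9)"
  have "sextic (listed_coeffs 6) (subst2 p q 1 (- 3) z) = ?f z" for z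
  proof -
    define X Y where "X = z $ 1" and "Y = z $ 2"
    have "184 * (p * X + q * Y) ^ 6 + 6 * (- 32) * (p * X + q * Y) ^ 5 * (X - 3 * Y)
      + 15 * (- 20) * (p * X + q * Y) ^ 4 * (X - 3 * Y) ^ 2
      + 20 * (- 16) * (p * X + q * Y) ^ 3 * (X - 3 * Y) ^ 3
      + 15 * (- 10) * (p * X + q * Y) ^ 2 * (X - 3 * Y) ^ 4
      + 6 * (- 8) * (p * X + q * Y) * (X - 3 * Y) ^ 5 + 23 * (X - 3 * Y) ^ 6 =
    (- 12662496 + 9350208 * n + 75089952 * t - 55447616 * n * t) * X ^ 6 +
    6 * (- 2119320 + 1564808 * n + 12566736 * t - 9279424 * n * t) * X ^ 5 * Y +
    20 * (- 29232 + 20440 * n + 165816 * t - 122696 * n * t) * X ^ 3 * Y ^ 3 +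
    (- 2390976 + 1830976 * n - 15382080 * t + 11019904 * n * t) * Y ^ 6"
      using n t unfolding p_def q_def by algebra
    then show ?thesis
      by (simp add: sextic_expand listed_coeffs_def X_def Y_def)
  qed
  \<comment> \<open>Eighteen times the inverse of the determinant, computed in that number field.\<close>
  moreover have "(p * (- 3) - q * 1) * (5 - n - 6 * t) = 18"
    using n t unfolding p_def q_def by algebra
  then have "p * (- 3) - q * 1 \<noteq> 0"
    by auto
  ultimately show ?thesis
    using linearly_equivalent_subst2[of p "- 3" q 1 "sextic (listed_coeffs 6)"] by simp
qed

text \<open>
  The two solutions \<open>m\<close> of the quadratic equation are conjugate over the rationals, and so are the two ways of
  transforming the last form. Both invariants under rescaling agree with the given ones.
\<close>

lemma equivalent_listed_6_if_parameters:
  assumes zero: "a 2 = 0" "a 4 = 0" "a 5 = 0" and a3: "a 3 = 1" and a6: "a 6 \<noteq> 0"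
    and m: "m ^ 2 + 46 * m + 81 = 0" "a 0 * a 6 = 1 - m" and P: "a 1 ^ 3 * a 6 ^ 2 = - 216 - 104 * m"
  shows "linearly_equivalent (sextic a) (sextic (listed_coeffs 6))"
proof -
  \<comment> \<open>Then \<open>m = - n\<^sup>2\<close>, so that \<open>n = 4 \<plusminus> \<surd>7\<close>.\<close>
  define n where "n = (9 - m) / 8"
  have mn: "m = 9 - 8 * n"
    by (simp add: n_def field_simps)
  have n: "n ^ 2 = 8 * n - 9"
  proof -
    have "64 * (n ^ 2 - 8 * n + 9) = m ^ 2 + 46 * m + 81"
      unfolding mn by algebra
    then have "64 * (n ^ 2 - 8 * n + 9) = 0"
      by (simp only: m)
    then have "n ^ 2 - 8 * n + 9 = 0"
      by (metis mult_eq_0_iff zero_neq_numeral)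
    then show ?thesis
      by algebra
  qed
  define t where "t = csqrt ((4 * n - 23) / 126)"
  have t: "126 * t ^ 2 = 4 * n - 23"
    by (simp add: t_def)
  define b0 b1 b3 b6 where "b0 = - 12662496 + 9350208 * n + 75089952 * t - 55447616 * n * t"
    and "b1 = - 2119320 + 1564808 * n + 12566736 * t - 9279424 * n * t"
    and "b3 = - 29232 + 20440 * n + 165816 * t - 122696 * n * t"
    and "b6 = - 2390976 + 1830976 * n - 15382080 * t + 11019904 * n * t"
  define b where "b = (\<lambda>k::nat. [b0, b1, 0, b3, 0, 0, b6] ! k)"
  have b: "b 0 = b0" "b 1 = b1" "b 2 = 0" "b 3 = b3" "b 4 = 0" "b 5 = 0" "b 6 = b6"
    by (simp_all add: b_def eval_nat_numeral)
  \<comment> \<open>The second factors are multiples of the inverses in the field generated by \<open>n\<close> and \<open>t\<close>.\<close>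
  have "b1 * (- 367 + 20 * n + 147 * t - 231 * n * t) = 63504"
    unfolding b1_def using n t by algebra
  then have "b1 \<noteq> 0"
    by auto
  have "b3 * (- 145 + 17 * n + 84 * t - 42 * n * t) = 190512"
    unfolding b3_def using n t by algebra
  then have "b3 \<noteq> 0"
    by auto
  have "b6 * (- 31 + 41 * n + 525 * t - 294 * n * t) = 10287648"
    unfolding b6_def using n t by algebra
  then have "b6 \<noteq> 0"
    by auto
  have "linearly_equivalent (sextic a) (sextic b)"
  proof (rule linearly_equivalent_by_scaling)
    have "(1 - m) * b3 ^ 2 = b0 * b6"
      unfolding mn b0_def b3_def b6_def using n t by algebra
    then show "a 0 * a 6 * b 3 ^ 2 = b 0 * b 6 * a 3 ^ 2"
      unfolding b a3 m(2) by simp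
    have "(- 216 - 104 * m) * b3 ^ 5 = b1 ^ 3 * b6 ^ 2"
      unfolding mn b1_def b3_def b6_def using n t by algebra
    then show "a 1 ^ 3 * a 6 ^ 2 * b 3 ^ 5 = b 1 ^ 3 * b 6 ^ 2 * a 3 ^ 5"
      unfolding b a3 P by simp
  qed (use \<open>b1 \<noteq> 0\<close> \<open>b3 \<noteq> 0\<close> \<open>b6 \<noteq> 0\<close> in \<open>simp_all only: zero a3 a6 b one_neq_zero not_False_eq_True\<close>)
  also have "sextic b = (\<lambda>z. b0 * (z $ 1) ^ 6 + 6 * b1 * (z $ 1) ^ 5 * z $ 2
      + 20 * b3 * (z $ 1) ^ 3 * (z $ 2) ^ 3 + b6 * (z $ 2) ^ 6)"
    by (rule ext) (simp only: sextic_expand b, simp)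
  finally show ?thesis
    using listed_6_double_root_form[OF n t] linearly_equivalent_sym linearly_equivalent_trans
    unfolding b0_def b1_def b3_def b6_def by blast
qed

section \<open>Classification of the sextics that are not reducible\<close>

text \<open>
  The effect of \<open>y \<mapsto> y + s x\<close>.
\<close>

lemma linearly_equivalent_lower_shear:
  "linearly_equivalent (sextic a) (sextic (\<lambda>k. shift s (\<lambda>k. a (6 - k)) (6 - k)))"
  using linearly_equivalent_trans linearly_equivalent_reverse linearly_equivalent_shift by meson

definition listed :: "(complex^2 \<Rightarrow> complex) \<Rightarrow> bool" where
  "listed f \<longleftrightarrow> (\<exists>i<7. linearly_equivalent f (sextic (listed_coeffs i)))"

lemma listedI: "linearly_equivalent f (sextic (listed_coeffs i)) \<Longrightarrow> i < 7 \<Longrightarrow> listed f"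
  unfolding listed_def by blast

lemma listed_linearly_equivalent: "linearly_equivalent f g \<Longrightarrow> listed g \<Longrightarrow> listed f"
  unfolding listed_def using linearly_equivalent_trans by blast

lemma listed_coeffs_simps:
  "listed_coeffs 0 = (\<lambda>k. [0, 0, 1 / 15, 0, 0, 0, 0] ! k)"
  "listed_coeffs 1 = (\<lambda>k. [1, 0, 1 / 15, 0, 0, 0, 0] ! k)"
  "listed_coeffs 2 = (\<lambda>k. [0, 0, 0, 1 / 20, 0, 0, 0] ! k)"
  "listed_coeffs 3 = (\<lambda>k. [0, 1 / 6, 0, 0, 0, 0, 0] ! k)"
  "listed_coeffs 4 = (\<lambda>k. [1, 0, 0, 0, 0, 1 / 6, 0] ! k)"
  "listed_coeffs 5 = (\<lambda>k. [2, 3, 0, 1 / 2, 0, 0, - 1] ! k)"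
  "listed_coeffs 6 = (\<lambda>k. [184, - 32, - 20, - 16, - 10, - 8, 23] ! k)"
  by (simp_all add: listed_coeffs_def fun_eq_iff eval_nat_numeral)

lemma nth_list7:
  "[c0, c1, c2, c3, c4, c5, c6] ! 0 = c0" "[c0, c1, c2, c3, c4, c5, c6] ! 1 = c1"
  "[c0, c1, c2, c3, c4, c5, c6] ! 2 = c2" "[c0, c1, c2, c3, c4, c5, c6] ! 3 = c3"
  "[c0, c1, c2, c3, c4, c5, c6] ! 4 = c4" "[c0, c1, c2, c3, c4, c5, c6] ! 5 = c5"
  "[c0, c1, c2, c3, c4, c5, c6] ! 6 = c6"
  by (simp_all add: eval_nat_numeral)

lemma linearly_equivalent_scaleI:
  assumes "p \<noteq> 0" "q \<noteq> 0" "p ^ 6 * a 0 = b 0" "p ^ 5 * q * a 1 = b 1" "p ^ 4 * q ^ 2 * a 2 = b 2"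
    "p ^ 3 * q ^ 3 * a 3 = b 3" "p ^ 2 * q ^ 4 * a 4 = b 4" "p * q ^ 5 * a 5 = b 5" "q ^ 6 * a 6 = b 6"
  shows "linearly_equivalent (sextic a) (sextic b)"
proof -
  have "sextic (\<lambda>k. p ^ (6 - k) * q ^ k * a k) = sextic b"
    using assms by (simp add: sextic_expand fun_eq_iff)
  then show ?thesis
    using linearly_equivalent_scale[OF assms(1,2), of a] by simp
qed

text \<open>
  If \<open>a\<^sub>6 = 0\<close>, the eigenvalues are \<open>\<plusminus>3\<close> and \<open>\<plusminus>1\<close>; those for \<open>- 3\<close> and \<open>1\<close> have repeated factors only
  for a multiple of \<open>x\<^sup>3 y\<^sup>3\<close>. Otherwise the two possible pairs of parameters belong to the last two forms.
\<close>

lemma listed_double_root_form_normalized: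
  assumes zero: "a 2 = 0" "a 4 = 0" "a 5 = 0" and a3: "a 3 = 1"
    and irred: "\<not> sylvester_reducible (sextic a)"
  shows "listed (sextic a)"
proof (cases "a 6 = 0")
  case True
  have "(12 * a 1) ^ 2 * 0 ^ 2 - 6 * (12 * a 1) * 0 * 8 * 0 + 4 * (12 * a 1) * 8 ^ 3 + 4 * 0 ^ 3 * 0
      - 3 * 0 ^ 2 * 8 ^ 2 = 0"
    by (rule discriminant_eq_0_if_not_reducible[OF irred, where l = "- 3"])
      (use zero a3 True in algebra)+
  then have a1: "a 1 = 0"
    by simp
  have "2 * (a 0 ^ 2 * 2 + 4 * 0 ^ 3) = 0"
    by (rule depressed_discriminant_eq_0_if_not_reducible[OF irred, where l = 1])
      (use zero a3 True a1 in simp_all)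
  then have a0: "a 0 = 0"
    by simp
  obtain p where p: "p ^ 3 = (1 / 20 :: complex)"
    using ex_root_complex[OF zero_less_numeral] by blast
  then have "p \<noteq> 0"
    by auto
  then have "linearly_equivalent (sextic a) (sextic (listed_coeffs 2))"
    by (intro linearly_equivalent_scaleI[of p 1])
      (use p in \<open>simp_all only: listed_coeffs_simps nth_list7 zero a3 True a0 a1, simp_all\<close>)
  then show ?thesis
    by (rule listedI) simp
next
  case False
  define m where "m = 1 - a 0 * a 6"
  have m: "a 0 * a 6 = 1 - m"
    by (simp add: m_def)
  consider "m = 9" "a 1 ^ 3 * a 6 ^ 2 = 864"
    | "m ^ 2 + 46 * m + 81 = 0" "a 1 ^ 3 * a 6 ^ 2 = - 216 - 104 * m"
    using double_root_form_parameters[OF zero a3 False irred] unfolding m_def by blast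
  then show ?thesis
  proof cases
    case 1
    have "linearly_equivalent (sextic a) (sextic (listed_coeffs 5))"
      by (rule linearly_equivalent_by_scaling)
        (use False in \<open>simp_all only: listed_coeffs_simps nth_list7 zero a3 m 1, simp_all add: power_divide\<close>)
    then show ?thesis
      by (rule listedI) simp
  next
    case 2
    then have "linearly_equivalent (sextic a) (sextic (listed_coeffs 6))"
      using m by (intro equivalent_listed_6_if_parameters[OF zero a3 False, of m]) auto
    then show ?thesis
      by (rule listedI) simp
  qed
qed

lemma not_reducible_linearly_equivalent:
  "\<not> sylvester_reducible f \<Longrightarrow> linearly_equivalent f g \<Longrightarrow> \<not> sylvester_reducible g"
  using sylvester_reducible_linearly_equivalent by blast

lemma listed_double_root_form:
  assumes zero: "a 2 = 0" "a 4 = 0" "a 5 = 0" and a3: "a 3 \<noteq> 0"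
    and irred: "\<not> sylvester_reducible (sextic a)"
  shows "listed (sextic a)"
proof -
  obtain p where p: "p ^ 3 = 1 / a 3"
    using ex_root_complex[OF zero_less_numeral] by blast
  then have "p \<noteq> 0"
    using a3 by auto
  let ?b = "\<lambda>k. p ^ (6 - k) * 1 ^ k * a k"
  have eq: "linearly_equivalent (sextic a) (sextic ?b)"
    using \<open>p \<noteq> 0\<close> by (intro linearly_equivalent_scale) auto
  then have "\<not> sylvester_reducible (sextic ?b)"
    using irred not_reducible_linearly_equivalent by blast
  then have "listed (sextic ?b)"
    by (intro listed_double_root_form_normalized) (use zero p a3 in simp_all)
  then show ?thesis
    using eq listed_linearly_equivalent by blast
qed

text \<open>
  The sextic is \<open>x\<^sup>4\<close> times a quadratic form, which is brought to a normal form by a shear that fixes \<open>x\<close>. Only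
  multiples of \<open>x\<^sup>6\<close> are left over, and these are reducible.
\<close>

lemma listed_quadruple_root:
  assumes zero: "a 3 = 0" "a 4 = 0" "a 5 = 0" "a 6 = 0"
    and irred: "\<not> sylvester_reducible (sextic a)"
  shows "listed (sextic a)"
proof (cases "a 2 = 0")
  case a2: False
  define s where "s = - a 1 / (5 * a 2)"
  define b where "b = (\<lambda>k. shift s (\<lambda>k. a (6 - k)) (6 - k))"
  have eq: "linearly_equivalent (sextic a) (sextic b)"
    unfolding b_def by (rule linearly_equivalent_lower_shear)
  have b: "b 1 = 0" "b 2 = a 2" "b 3 = 0" "b 4 = 0" "b 5 = 0" "b 6 = 0"
    using a2 by (simp_all add: b_def shift_simps[unfolded One_nat_def] zero s_def field_simps)
  have "listed (sextic b)"
  proof (cases "b 0 = 0")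
    case True
    obtain q where q: "q ^ 2 = 1 / (15 * a 2)"
      using ex_root_complex[OF zero_less_numeral] by blast
    then have "q \<noteq> 0"
      using a2 by auto
    then have "linearly_equivalent (sextic b) (sextic (listed_coeffs 0))"
      by (intro linearly_equivalent_scaleI[of 1 q])
        (use q a2 in \<open>simp_all only: listed_coeffs_simps nth_list7 b True, simp_all\<close>)
    then show ?thesis
      by (rule listedI) simp
  next
    case False
    obtain p where p: "p ^ 6 = 1 / b 0"
      using ex_root_complex[OF zero_less_numeral] by blast
    then have "p \<noteq> 0"
      using False by auto
    obtain q where q: "q ^ 2 = 1 / (15 * a 2 * p ^ 4)"
      using ex_root_complex[OF zero_less_numeral] by blast
    then have "q \<noteq> 0"
      using a2 \<open>p \<noteq> 0\<close> by auto
    then have "linearly_equivalent (sextic b) (sextic (listed_coeffs 1))"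
      using \<open>p \<noteq> 0\<close>
      by (intro linearly_equivalent_scaleI[of p q])
        (use p q a2 False in \<open>simp_all only: listed_coeffs_simps nth_list7 b, simp_all\<close>)
    then show ?thesis
      by (rule listedI) simp
  qed
  then show ?thesis
    using eq listed_linearly_equivalent by blast
next
  case a2: True
  have "a 1 \<noteq> 0"
  proof
    assume "a 1 = 0"
    \<comment> \<open>The cubic \<open>3 x y\<^sup>2 - 3 x\<^sup>3\<close> is annihilated by the transvectant with \<open>x\<^sup>6\<close>.\<close>
    then have "(- 3) ^ 2 * 0 ^ 2 - 6 * (- 3) * 0 * 1 * 0 + 4 * (- 3) * 1 ^ 3 + 4 * 0 ^ 3 * 0
      - 3 * 0 ^ 2 * 1 ^ 2 = (0::complex)"
      by (intro discriminant_eq_0_if_not_reducible[OF irred, where l = 0]) (simp_all add: zero a2)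
    then show False
      by simp
  qed
  define s where "s = - a 0 / (6 * a 1)"
  define b where "b = (\<lambda>k. shift s (\<lambda>k. a (6 - k)) (6 - k))"
  have eq: "linearly_equivalent (sextic a) (sextic b)"
    unfolding b_def by (rule linearly_equivalent_lower_shear)
  have b: "b 0 = 0" "b 1 = a 1" "b 2 = 0" "b 3 = 0" "b 4 = 0" "b 5 = 0" "b 6 = 0"
    using \<open>a 1 \<noteq> 0\<close> by (simp_all add: b_def shift_simps[unfolded One_nat_def] zero a2 s_def field_simps)
  have "linearly_equivalent (sextic b) (sextic (listed_coeffs 3))"
    by (rule linearly_equivalent_scaleI[of 1 "1 / (6 * a 1)"])
      (use \<open>a 1 \<noteq> 0\<close> in \<open>simp_all only: listed_coeffs_simps nth_list7 b, simp_all\<close>)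
  then show ?thesis
    using eq by (intro listedI[of _ 3]) (auto intro: linearly_equivalent_trans)
qed

text \<open>
  A shear that fixes \<open>x\<close> removes the coefficient \<open>a\<^sub>2\<close>, which leads back to the eigencubic \<open>x\<^sup>2 y\<close>.
\<close>

lemma listed_triple_root:
  assumes zero: "a 4 = 0" "a 5 = 0" "a 6 = 0"
    and irred: "\<not> sylvester_reducible (sextic a)"
  shows "listed (sextic a)"
proof (cases "a 3 = 0")
  case True
  then show ?thesis
    using assms by (intro listed_quadruple_root)
next
  case a3: False
  define s where "s = - a 2 / (4 * a 3)"
  define b where "b = (\<lambda>k. shift s (\<lambda>k. a (6 - k)) (6 - k))"
  have eq: "linearly_equivalent (sextic a) (sextic b)"
    unfolding b_def by (rule linearly_equivalent_lower_shear)
  have b: "b 2 = 0" "b 3 = a 3" "b 4 = 0" "b 5 = 0"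
    using a3 by (simp_all add: b_def shift_simps[unfolded One_nat_def] zero s_def field_simps)
  have "listed (sextic b)"
    by (rule listed_double_root_form)
      (use b a3 eq irred not_reducible_linearly_equivalent in auto)
  then show ?thesis
    using eq listed_linearly_equivalent by blast
qed

text \<open>
  The eigenvalues are \<open>0\<close> and the two square roots of \<open>- a\<^sub>0 a\<^sub>6\<close>. The discriminants for the
  latter cannot both vanish unless \<open>a\<^sub>0 = 0\<close>, and a multiple of \<open>y\<^sup>6\<close> is reducible.
\<close>

lemma listed_nilpotent_double_root_form:
  assumes zero: "a 2 = 0" "a 3 = 0" "a 4 = 0" "a 5 = 0" and a6: "a 6 \<noteq> 0"
    and irred: "\<not> sylvester_reducible (sextic a)"
  shows "listed (sextic a)"
proof -
  have eig: "l * (l ^ 5 + 4 * (a 1 ^ 3 * a 6 ^ 2)) = 0" if l: "l ^ 2 = - (a 0 * a 6)" for l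
  proof -
    have "- (a 6 * l) * ((l ^ 2) ^ 2 * (- (a 6 * l)) + 4 * (- (a 1 * a 6)) ^ 3) = 0"
      by (rule depressed_discriminant_eq_0_if_not_reducible[OF irred, where l = l])
        (use l zero in algebra)+
    then have "a 6 ^ 2 * (l * (l ^ 5 + 4 * (a 1 ^ 3 * a 6 ^ 2))) = 0"
      by algebra
    then show ?thesis
      using a6 by simp
  qed
  define l where "l = csqrt (- (a 0 * a 6))"
  have l: "l ^ 2 = - (a 0 * a 6)"
    by (simp add: l_def)
  have "l * (l ^ 5 + 4 * (a 1 ^ 3 * a 6 ^ 2)) = 0" "- l * ((- l) ^ 5 + 4 * (a 1 ^ 3 * a 6 ^ 2)) = 0"
    using eig[of l] eig[of "- l"] l by simp_all
  then have "l ^ 6 = 0"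
    by algebra
  then have a0: "a 0 = 0"
    using l a6 by simp
  have a1: "a 1 \<noteq> 0"
  proof
    assume "a 1 = 0"
    then have "- 3 * (0 ^ 2 * (- 3) + 4 * 1 ^ 3) = (0 :: complex)"
      by (intro depressed_discriminant_eq_0_if_not_reducible[OF irred, where l = 0])
        (simp_all add: zero a0)
    then show False
      by simp
  qed
  let ?b = "\<lambda>k. a (6 - k)"
  obtain p where p: "p ^ 6 = 1 / a 6"
    using ex_root_complex[OF zero_less_numeral] by blast
  then have "p \<noteq> 0"
    using a6 by auto
  obtain q where q: "q ^ 5 = 1 / (6 * a 1 * p)"
    using ex_root_complex[OF zero_less_numeral] by blast
  then have "q \<noteq> 0"
    using a1 \<open>p \<noteq> 0\<close> by auto
  have "linearly_equivalent (sextic ?b) (sextic (listed_coeffs 4))"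
    by (rule linearly_equivalent_scaleI[OF \<open>p \<noteq> 0\<close> \<open>q \<noteq> 0\<close>])
      (use p q a1 a6 \<open>p \<noteq> 0\<close> in \<open>simp_all only: listed_coeffs_simps nth_list7, simp_all add: zero a0\<close>)
  then show ?thesis
    using linearly_equivalent_reverse by (intro listedI[of _ 4]) (auto intro: linearly_equivalent_trans)
qed

theorem listed_if_not_reducible:
  assumes irred: "\<not> sylvester_reducible (sextic a)"
  shows "listed (sextic a)"
proof -
  obtain g l where g: "eigencubic a g l"
    using ex_eigencubic by blast
  then have "cubic_discriminant g = 0"
    using irred sylvester_reducible_if_eigencubic by blast
  then obtain b where eq: "linearly_equivalent (sextic a) (sextic b)"
    and b: "b 2 = 0 \<and> b 4 = 0 \<and> b 5 = 0 \<or> b 4 = 0 \<and> b 5 = 0 \<and> b 6 = 0"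
    using degenerate_eigencubic[OF g] by metis
  have "\<not> sylvester_reducible (sextic b)"
    using eq irred not_reducible_linearly_equivalent by blast
  then have "listed (sextic b)"
    using b listed_triple_root listed_double_root_form listed_nilpotent_double_root_form by metis
  then show ?thesis
    using eq listed_linearly_equivalent by blast
qed

section \<open>Inequivalence of the seven forms\<close>

lemma sextic_coefficients_eq_0:
  assumes "\<And>x y :: complex. c0 * x ^ 6 + c1 * x ^ 5 * y + c2 * x ^ 4 * y ^ 2 + c3 * x ^ 3 * y ^ 3
    + c4 * x ^ 2 * y ^ 4 + c5 * x * y ^ 5 + c6 * y ^ 6 = 0"
  shows "c0 = 0" "c1 = 0" "c2 = 0" "c3 = 0" "c4 = 0" "c5 = 0" "c6 = 0"
proof -
  define c where "c = (\<lambda>k::nat. [c0, c1 / 6, c2 / 15, c3 / 20, c4 / 15, c5 / 6, c6] ! k)"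
  have c: "c 0 = c0" "c 1 = c1 / 6" "c 2 = c2 / 15" "c 3 = c3 / 20" "c 4 = c4 / 15" "c 5 = c5 / 6" "c 6 = c6"
    unfolding c_def by (rule nth_list7)+
  have "sextic c = sextic (\<lambda>_. 0)"
    using assms by (intro ext) (simp only: sextic_expand c, simp)
  then have "c k = 0" if "k \<le> 6" for k
    using sextic_eqD that by blast
  from this[of 0] this[of 1] this[of 2] this[of 3] this[of 4] this[of 5] this[of 6]
  show "c0 = 0" "c1 = 0" "c2 = 0" "c3 = 0" "c4 = 0" "c5 = 0" "c6 = 0"
    unfolding c by simp_all
qed

text \<open>
  The last coefficients of the transformed sextic show that \<open>q = 0\<close>, since the multiplicity 4 forces the quadruple
  factor onto \<open>x\<close>. The other factor is a square in one form but not in the other.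
\<close>

lemma not_equivalent_0_1:
  "\<not> linearly_equivalent (sextic (listed_coeffs 0)) (sextic (listed_coeffs 1))"
proof
  assume "linearly_equivalent (sextic (listed_coeffs 0)) (sextic (listed_coeffs 1))"
  then obtain p q r s where det: "p * s - q * r \<noteq> 0"
    and eq: "sextic (listed_coeffs 1) = (\<lambda>z. sextic (listed_coeffs 0) (subst2 p q r s z))"
    unfolding linearly_equivalent_iff_subst2 by blast
  have eq': "x ^ 6 + x ^ 4 * y ^ 2 = (p * x + q * y) ^ 4 * (r * x + s * y) ^ 2" for x y
    using fun_cong[OF eq, of "vector [x, y]"]
    unfolding sextic_expand listed_coeffs_simps nth_list7 by simp
  have "(p ^ 4 * r ^ 2 - 1) * x ^ 6 + (4 * p ^ 3 * q * r ^ 2 + 2 * p ^ 4 * r * s) * x ^ 5 * y +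
    (6 * p ^ 2 * q ^ 2 * r ^ 2 + 8 * p ^ 3 * q * r * s + p ^ 4 * s ^ 2 - 1) * x ^ 4 * y ^ 2 +
    (4 * p * q ^ 3 * r ^ 2 + 12 * p ^ 2 * q ^ 2 * r * s + 4 * p ^ 3 * q * s ^ 2) * x ^ 3 * y ^ 3 +
    (q ^ 4 * r ^ 2 + 8 * p * q ^ 3 * r * s + 6 * p ^ 2 * q ^ 2 * s ^ 2) * x ^ 2 * y ^ 4 +
    (2 * q ^ 4 * r * s + 4 * p * q ^ 3 * s ^ 2) * x * y ^ 5 + q ^ 4 * s ^ 2 * y ^ 6 = 0" for x y
    using eq'[of x y] by algebra
  note c = sextic_coefficients_eq_0[OF this]
  show False
  proof (cases "q = 0")
    case True
    then show False
      using c(1-3) by auto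
  next
    case False
    then show False
      using c(5,7) det by auto
  qed
qed

text \<open>
  Both targets are divisible by \<open>x\<^sup>4\<close>, so the factor of multiplicity 5 would have to be a multiple of \<open>x\<close>; but neither
  target is divisible by \<open>x\<^sup>5\<close>.
\<close>

lemma not_equivalent_3:
  assumes i: "i = 0 \<or> i = 1"
  shows "\<not> linearly_equivalent (sextic (listed_coeffs 3)) (sextic (listed_coeffs i))"
proof
  assume "linearly_equivalent (sextic (listed_coeffs 3)) (sextic (listed_coeffs i))"
  then obtain p q r s where det: "p * s - q * r \<noteq> 0"
    and eq: "sextic (listed_coeffs i) = (\<lambda>z. sextic (listed_coeffs 3) (subst2 p q r s z))"
    unfolding linearly_equivalent_iff_subst2 by blast
  have eq': "listed_coeffs i 0 * x ^ 6 + x ^ 4 * y ^ 2 = (p * x + q * y) ^ 5 * (r * x + s * y)" for x y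
    using i fun_cong[OF eq, of "vector [x, y]"]
    by (elim disjE; hypsubst; unfold sextic_expand listed_coeffs_simps nth_list7; simp)
  have "(p ^ 5 * r - listed_coeffs i 0) * x ^ 6 + (p ^ 5 * s + 5 * p ^ 4 * q * r) * x ^ 5 * y +
    (5 * p ^ 4 * q * s + 10 * p ^ 3 * q ^ 2 * r - 1) * x ^ 4 * y ^ 2 +
    (10 * p ^ 3 * q ^ 2 * s + 10 * p ^ 2 * q ^ 3 * r) * x ^ 3 * y ^ 3 +
    (10 * p ^ 2 * q ^ 3 * s + 5 * p * q ^ 4 * r) * x ^ 2 * y ^ 4 +
    (5 * p * q ^ 4 * s + q ^ 5 * r) * x * y ^ 5 + q ^ 5 * s * y ^ 6 = 0" for x y
    using eq'[of x y] by algebra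
  note c = sextic_coefficients_eq_0[OF this]
  show False
    using c(3,6,7) det by (cases "q = 0") auto
qed

text \<open>
  The fifth form has six distinct linear factors, whereas the others are divisible by \<open>x\<^sup>2\<close>: the coefficients of
  \<open>y\<^sup>6\<close> and \<open>x y\<^sup>5\<close> cannot both vanish.
\<close>

lemma not_equivalent_4:
  assumes i: "i = 0 \<or> i = 1 \<or> i = 3"
  shows "\<not> linearly_equivalent (sextic (listed_coeffs 4)) (sextic (listed_coeffs i))"
proof
  assume "linearly_equivalent (sextic (listed_coeffs 4)) (sextic (listed_coeffs i))"
  then obtain p q r s where det: "p * s - q * r \<noteq> 0"
    and eq: "sextic (listed_coeffs i) = (\<lambda>z. sextic (listed_coeffs 4) (subst2 p q r s z))"
    unfolding linearly_equivalent_iff_subst2 by blast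
  obtain b0 b1 b2 where eq': "b0 * x ^ 6 + b1 * x ^ 5 * y + b2 * x ^ 4 * y ^ 2 =
    (p * x + q * y) ^ 6 + (p * x + q * y) * (r * x + s * y) ^ 5" for x y
  proof
    show "listed_coeffs i 0 * x ^ 6 + 6 * listed_coeffs i 1 * x ^ 5 * y + 15 * listed_coeffs i 2 * x ^ 4 * y ^ 2 =
      (p * x + q * y) ^ 6 + (p * x + q * y) * (r * x + s * y) ^ 5" for x y
      using i fun_cong[OF eq, of "vector [x, y]"]
      by (elim disjE; hypsubst; unfold sextic_expand listed_coeffs_simps nth_list7; simp)
  qed
  have "(p ^ 6 + p * r ^ 5 - b0) * x ^ 6 + (6 * p ^ 5 * q + q * r ^ 5 + 5 * p * r ^ 4 * s - b1) * x ^ 5 * y +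
    (15 * p ^ 4 * q ^ 2 + 5 * q * r ^ 4 * s + 10 * p * r ^ 3 * s ^ 2 - b2) * x ^ 4 * y ^ 2 +
    (20 * p ^ 3 * q ^ 3 + 10 * q * r ^ 3 * s ^ 2 + 10 * p * r ^ 2 * s ^ 3) * x ^ 3 * y ^ 3 +
    (15 * p ^ 2 * q ^ 4 + 10 * q * r ^ 2 * s ^ 3 + 5 * p * r * s ^ 4) * x ^ 2 * y ^ 4 +
    (6 * p * q ^ 5 + 5 * q * r * s ^ 4 + p * s ^ 5) * x * y ^ 5 + (q ^ 6 + q * s ^ 5) * y ^ 6 = 0" for x y
    using eq'[of x y] by algebra
  note c = sextic_coefficients_eq_0[OF this]
  show False
  proof (cases "q = 0")
    case True
    then show False
      using c(6) det by auto
  next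
    case False
    have "q * (q ^ 5 + s ^ 5) = 0"
      using c(7) by algebra
    then have qs: "q ^ 5 + s ^ 5 = 0"
      using False by simp
    then have "s \<noteq> 0"
      using False by auto
    have "5 * s ^ 4 * (p * s - q * r) = 0"
      using c(6) qs by algebra
    then show False
      using \<open>s \<noteq> 0\<close> det by simp
  qed
qed

lemma list_invariants:
  "quadratic_invariant (listed_coeffs 0) = 0" "quadratic_invariant (listed_coeffs 1) = 0"
  "quadratic_invariant (listed_coeffs 2) = - 1 / 40" "quadratic_invariant (listed_coeffs 3) = 0"
  "quadratic_invariant (listed_coeffs 4) = 0" "quadratic_invariant (listed_coeffs 5) = - 9 / 2"
  "quadratic_invariant (listed_coeffs 6) = 3136"
  "catalecticant (listed_coeffs 2) = 1 / 160000" "catalecticant (listed_coeffs 5) = 9 / 16"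
  "catalecticant (listed_coeffs 6) = - 351232"
  unfolding quadratic_invariant_def catalecticant_def listed_coeffs_simps nth_list7
  by (simp_all add: power2_eq_square)

lemma less_7_iff: "i < 7 \<longleftrightarrow> i = 0 \<or> i = 1 \<or> i = 2 \<or> i = 3 \<or> i = 4 \<or> i = 5 \<or> i = (6::nat)"
  by auto

text \<open>
  The quotient of \<open>I\<^sup>2\<close> by \<open>C\<close> is the same for equivalent sextics. Where both invariants vanish it is \<open>0\<close>, by
  the convention for division by zero.
\<close>

theorem listed_coeffs_inequivalent:
  assumes "linearly_equivalent (sextic (listed_coeffs i)) (sextic (listed_coeffs j))" "i < 7" "j < 7"
  shows "i = j"
proof -
  obtain d where d: "d \<noteq> 0" "quadratic_invariant (listed_coeffs j) = d ^ 6 * quadratic_invariant (listed_coeffs i)"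
    "catalecticant (listed_coeffs j) = d ^ 12 * catalecticant (listed_coeffs i)"
    using invariants_linearly_equivalent[OF assms(1)] by metis
  define r where "r i = quadratic_invariant (listed_coeffs i) ^ 2 / catalecticant (listed_coeffs i)" for i
  have r: "r 0 = 0" "r 1 = 0" "r 2 = 100" "r 3 = 0" "r 4 = 0" "r 5 = 36" "r 6 = - 28"
    unfolding r_def list_invariants by (simp_all add: power2_eq_square)
  have "r j = r i"
    using d(1) unfolding d(2,3) r_def by (simp add: power_mult_distrib flip: power_mult)
  then have "i = j \<or> i \<in> {0, 1, 3, 4} \<and> j \<in> {0, 1, 3, 4}"
    using assms(2,3) unfolding less_7_iff by (elim disjE; hypsubst; simp add: r r[unfolded One_nat_def])
  then consider "i = j" | "i \<in> {0, 1, 3, 4}" "j \<in> {0, 1, 3, 4}"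
    by blast
  then show ?thesis
  proof cases
    case 2
    then show ?thesis
      using assms(1) linearly_equivalent_sym[OF assms(1)] not_equivalent_0_1 not_equivalent_3 not_equivalent_4
      by auto
  qed
qed

section \<open>Generic sextics\<close>

text \<open>
  Each factor vanishes on some of the seven orbits: \<open>I\<close> on the four whose operator is nilpotent, and the other factors
  on the third, sixth and seventh form, in this order.
\<close>

definition generic_invariant :: "(nat \<Rightarrow> complex) \<Rightarrow> complex" where
  "generic_invariant a = quadratic_invariant a *
     ((100 * catalecticant a - (quadratic_invariant a) ^ 2) *
      ((36 * catalecticant a - (quadratic_invariant a) ^ 2) *
       (28 * catalecticant a + (quadratic_invariant a) ^ 2)))"

lemma generic_invariant_list: "i < 7 \<Longrightarrow> generic_invariant (listed_coeffs i) = 0"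
  unfolding less_7_iff
  by (elim disjE; hypsubst; unfold generic_invariant_def list_invariants; simp add: power2_eq_square)

lemma sylvester_reducible_if_generic:
  assumes "generic_invariant a \<noteq> 0"
  shows "sylvester_reducible (sextic a)"
proof (rule ccontr)
  assume "\<not> sylvester_reducible (sextic a)"
  then obtain i where i: "i < 7" "linearly_equivalent (sextic a) (sextic (listed_coeffs i))"
    using listed_if_not_reducible unfolding listed_def by blast
  obtain d where d: "d \<noteq> 0" "quadratic_invariant (listed_coeffs i) = d ^ 6 * quadratic_invariant a"
    "catalecticant (listed_coeffs i) = d ^ 12 * catalecticant a"
    using invariants_linearly_equivalent[OF i(2)] by metis
  have "generic_invariant (listed_coeffs i) = d ^ 42 * generic_invariant a"
    unfolding generic_invariant_def d by algebra
  then show False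
    using generic_invariant_list[OF i(1)] d(1) assms by simp
qed

lemma coeff_polynomial_divide:
  "coeff_polynomial n p \<Longrightarrow> coeff_polynomial n (\<lambda>c. p c / a)"
  using coeff_polynomial.mult[OF _ coeff_polynomial.const[of n "1 / a"], of p] by simp

lemma coeff_polynomial_diff:
  assumes "coeff_polynomial n p" "coeff_polynomial n q"
  shows "coeff_polynomial n (\<lambda>c. p c - q c)"
  using coeff_polynomial.add[OF assms(1) coeff_polynomial.mult[OF coeff_polynomial.const[of n "- 1"] assms(2)]]
  by simp

lemma coeff_polynomial_power:
  assumes "coeff_polynomial n p"
  shows "coeff_polynomial n (\<lambda>c. p c ^ k)"
  by (induction k) (simp_all add: coeff_polynomial.const coeff_polynomial.mult assms)

text \<open>
  The topology refers to plain coefficients, the invariants to binomially weighted ones.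
\<close>

lemma zariski_open_generic:
  "zariski_open 6 (sextic ` {a. generic_invariant a \<noteq> 0})"
proof -
  let ?a = "\<lambda>c k. c k / of_nat (6 choose k) :: complex"
  have "coeff_polynomial 6 (\<lambda>c. generic_invariant (?a c))"
    unfolding generic_invariant_def quadratic_invariant_def catalecticant_def
    by (intro coeff_polynomial_divide coeff_polynomial_diff coeff_polynomial_power coeff_polynomial.intros) simp_all
  moreover have "sextic ` {a. generic_invariant a \<noteq> 0} = form_of 6 ` {c. generic_invariant (?a c) \<noteq> 0}"
  proof -
    have form: "form_of 6 c = sextic (?a c)" for c
      by (auto simp: form_of_def sextic_def fun_eq_iff intro!: sum.cong)
    have "\<exists>c. sextic a = form_of 6 c \<and> generic_invariant (?a c) = generic_invariant a" for a
    proof (intro exI conjI)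
      let ?c = "\<lambda>k. of_nat (6 choose k) * a k"
      show "sextic a = form_of 6 ?c"
        by (simp add: form_of_def sextic_def fun_eq_iff)
      have "?a ?c k = a k" if "k \<le> 6" for k
        using that by simp
      then show "generic_invariant (?a ?c) = generic_invariant a"
        by (simp add: generic_invariant_def quadratic_invariant_def catalecticant_def)
    qed
    then show ?thesis
      unfolding form by (auto simp: image_iff) (metis form)
  qed
  ultimately show ?thesis
    unfolding zariski_open_def by (intro exI[of _ "{\<lambda>c. generic_invariant (?a c)}"]) simp
qed

lemma exceptional_sextic_iff:
  "exceptional_sextic f \<longleftrightarrow> (\<exists>a. f = sextic a \<and> \<not> sylvester_reducible (sextic a))"
  unfolding exceptional_sextic_def binary_sextic_iff sylvester_reducible_def by blast

theorem theorem5p2: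
  shows "(\<exists>U. zariski_open 6 U \<and> U \<noteq> {} \<and>
            (\<forall>f \<in> U. \<exists>g. sylvester_canonical g \<and> linearly_equivalent f g)) \<and>
         (\<forall>f. exceptional_sextic f \<longrightarrow>
            (\<exists>!i. i < length exceptional_list \<and>
                  linearly_equivalent f (exceptional_list ! i)))"
proof (intro conjI exI allI impI)
  show "zariski_open 6 (sextic ` {a. generic_invariant a \<noteq> 0})"
    by (rule zariski_open_generic)
  \<comment> \<open>For \<open>x\<^sup>6 + 20 x\<^sup>3 y\<^sup>3 + y\<^sup>6\<close> the invariants are \<open>I = - 9\<close> and \<open>C = 0\<close>.\<close>
  have "generic_invariant (\<lambda>k. if k \<in> {0, 3, 6} then 1 else 0) \<noteq> 0"
    by (simp add: generic_invariant_def quadratic_invariant_def catalecticant_def)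
  then show "sextic ` {a. generic_invariant a \<noteq> 0} \<noteq> {}"
    by blast
  show "\<forall>f \<in> sextic ` {a. generic_invariant a \<noteq> 0}. \<exists>g. sylvester_canonical g \<and> linearly_equivalent f g"
    using sylvester_reducible_if_generic unfolding sylvester_reducible_def by blast
next
  fix f
  assume "exceptional_sextic f"
  then obtain a where a: "f = sextic a" "\<not> sylvester_reducible (sextic a)"
    unfolding exceptional_sextic_iff by blast
  then obtain i where i: "i < 7" "linearly_equivalent f (sextic (listed_coeffs i))"
    using listed_if_not_reducible unfolding listed_def by blast
  have len: "length exceptional_list = 7"
    by (simp add: exceptional_list_def)
  have nth: "exceptional_list ! j = sextic (listed_coeffs j)" if "j < 7" for j
    using that unfolding exceptional_list_eq_sextic less_7_iff by (elim disjE) simp_all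
  show "\<exists>!i. i < length exceptional_list \<and> linearly_equivalent f (exceptional_list ! i)"
  proof (rule ex1I[of _ i])
    show "i < length exceptional_list \<and> linearly_equivalent f (exceptional_list ! i)"
      using i nth len by simp
  next
    fix j
    assume j: "j < length exceptional_list \<and> linearly_equivalent f (exceptional_list ! j)"
    then have "linearly_equivalent (sextic (listed_coeffs i)) (sextic (listed_coeffs j))"
      using i nth len linearly_equivalent_sym linearly_equivalent_trans by metis
    then show "j = i"
      using listed_coeffs_inequivalent i j len by metis
  qed
qed

end
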